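(* Let $G$ be a graph containing a cycle. Then $\mathrm{ctw}(G) \le \mathrm{tw}(G)\,(\ell(G)-2)$, i.e. the connected tree-width of $G$ is at most $\mathrm{tw}(G)(\ell(G)-2)$.
   Context: Graphs are finite, simple and undirected. A tree-decomposition of $G$ is a pair $(T,(V_t)_{t\in T})$ of a tree $T$ and vertex sets (parts) $V_t\subseteq V(G)$, one for each node $t$ of $T$, such that: $V(G)=\bigcup_{t}V_t$; every edge of $G$ has both ends in some $V_t$; and $V_{t_1}\cap V_{t_3}\subseteq V_{t_2}$ whenever $t_2$ lies on the path in $T$ from $t_1$ to $t_3$. Its width is $\max_t(|V_t|-1)$, and the tree-width $\mathrm{tw}(G)$ is the minimum width of a tree-decomposition of $G$. A vertex set $X\subseteq V(G)$ is called connected if the induced subgraph $G[X]$ is connected. A tree-decomposition is called connected if each of its parts is connected in $G$, and the connected tree-width $\mathrm{ctw}(G)$ is the minimum width of a connected tree-decomposition of $G$. $\ell(G)$ denotes the smallest natural number $\ell$ such that the cycles of $G$ of length at most $\ell$ generate the cycle space of $G$ (over $\mathbb{F}_2$). *)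

theory Defs
  imports Complex_Main "HOL-Library.Z2" "HOL-Library.Function_Algebras"
begin

record 'a graph =
  verts :: "'a set"
  edges :: "'a set set"

definition finite_simple_graph :: "'a graph \<Rightarrow> bool" where
  "finite_simple_graph G \<longleftrightarrow>
     finite (verts G) \<and> (\<forall>e\<in>edges G. e \<subseteq> verts G \<and> card e = 2)"

definition induced_subgraph :: "'a graph \<Rightarrow> 'a set \<Rightarrow> 'a graph" where
  "induced_subgraph G X = \<lparr>verts = X, edges = {e \<in> edges G. e \<subseteq> X}\<rparr>"

fun walk_edges :: "'a list \<Rightarrow> 'a set set" where
  "walk_edges (x # y # p) = insert {x, y} (walk_edges (y # p))"
| "walk_edges _ = {}"

text \<open>A path is given by its list of vertices, in order; it may consist of a single vertex.\<close>

definition is_path :: "'a graph \<Rightarrow> 'a list \<Rightarrow> bool" where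
  "is_path G p \<longleftrightarrow> p \<noteq> [] \<and> distinct p \<and> set p \<subseteq> verts G \<and> walk_edges p \<subseteq> edges G"

definition is_path_between :: "'a graph \<Rightarrow> 'a \<Rightarrow> 'a list \<Rightarrow> 'a \<Rightarrow> bool" where
  "is_path_between G u p v \<longleftrightarrow> is_path G p \<and> hd p = u \<and> last p = v"

definition connected_graph :: "'a graph \<Rightarrow> bool" where
  "connected_graph G \<longleftrightarrow>
     verts G \<noteq> {} \<and> (\<forall>u\<in>verts G. \<forall>v\<in>verts G. \<exists>p. is_path_between G u p v)"

definition connected_in :: "'a graph \<Rightarrow> 'a set \<Rightarrow> bool" where
  "connected_in G X \<longleftrightarrow> X \<subseteq> verts G \<and> connected_graph (induced_subgraph G X)"

text \<open>A cycle is given by the list of its vertices in cyclic order, without repeating the first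
  vertex at the end. Hence the length of the list is the length (number of edges) of the cycle.\<close>

definition cycle_edges :: "'a list \<Rightarrow> 'a set set" where
  "cycle_edges c = insert {last c, hd c} (walk_edges c)"

definition is_cycle :: "'a graph \<Rightarrow> 'a list \<Rightarrow> bool" where
  "is_cycle G c \<longleftrightarrow>
     length c \<ge> 3 \<and> distinct c \<and> set c \<subseteq> verts G \<and> cycle_edges c \<subseteq> edges G"

definition is_tree :: "'a graph \<Rightarrow> bool" where
  "is_tree T \<longleftrightarrow>
     finite_simple_graph T \<and> connected_graph T \<and> (\<nexists>c. is_cycle T c)"

definition tree_decomposition :: "'a graph \<Rightarrow> 't graph \<Rightarrow> ('t \<Rightarrow> 'a set) \<Rightarrow> bool" where
  "tree_decomposition G T P \<longleftrightarrow>
     is_tree T \<and>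
     verts G = (\<Union>t\<in>verts T. P t) \<and>
     (\<forall>e\<in>edges G. \<exists>t\<in>verts T. e \<subseteq> P t) \<and>
     (\<forall>t1 t2 t3 p. is_path_between T t1 p t3 \<and> t2 \<in> set p \<longrightarrow> P t1 \<inter> P t3 \<subseteq> P t2)"

definition connected_tree_decomposition :: "'a graph \<Rightarrow> 't graph \<Rightarrow> ('t \<Rightarrow> 'a set) \<Rightarrow> bool" where
  "connected_tree_decomposition G T P \<longleftrightarrow>
     tree_decomposition G T P \<and> (\<forall>t\<in>verts T. connected_in G (P t))"

definition width :: "'t graph \<Rightarrow> ('t \<Rightarrow> 'a set) \<Rightarrow> int" where
  "width T P = Max ((\<lambda>t. int (card (P t)) - 1) ` verts T)"

text \<open>Decomposition trees are finite, so taking their nodes to be natural numbers loses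
  no generality. Widths are integers because the empty graph has tree-width -1.\<close>

definition tree_width :: "'a graph \<Rightarrow> int" where
  "tree_width G =
     (LEAST w. \<exists>(T :: nat graph) P. tree_decomposition G T P \<and> width T P = w)"

definition connected_tree_width :: "'a graph \<Rightarrow> int" where
  "connected_tree_width G =
     (LEAST w. \<exists>(T :: nat graph) P. connected_tree_decomposition G T P \<and> width T P = w)"

text \<open>Edge sets are represented by their characteristic functions into the two-element
  field \<^typ>\<open>bit\<close>; pointwise addition is then symmetric difference.\<close>

definition edge_scale :: "bit \<Rightarrow> ('a set \<Rightarrow> bit) \<Rightarrow> 'a set \<Rightarrow> bit" where
  "edge_scale r f = (\<lambda>e. r * f e)"

global_interpretation edge_space: vector_space edge_scale
  by unfold_locales (auto simp: edge_scale_def fun_eq_iff algebra_simps)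

definition cycle_vector :: "'a list \<Rightarrow> 'a set \<Rightarrow> bit" where
  "cycle_vector c = (\<lambda>e. of_bool (e \<in> cycle_edges c))"

definition cycle_space :: "'a graph \<Rightarrow> ('a set \<Rightarrow> bit) set" where
  "cycle_space G = edge_space.span {cycle_vector c | c. is_cycle G c}"

definition cycles_generate :: "'a graph \<Rightarrow> nat \<Rightarrow> bool" where
  "cycles_generate G l \<longleftrightarrow>
     edge_space.span {cycle_vector c | c. is_cycle G c \<and> length c \<le> l} = cycle_space G"

definition cycle_generation_length :: "'a graph \<Rightarrow> nat" where
  "cycle_generation_length G = (LEAST l. cycles_generate G l)"

end

theory Submission
  imports Defs
begin

text \<open>
  The tree-decomposition is traded for a recursion on territories: a connected set \<open>C\<close> with boundary
  \<open>N(C)\<close> gets a bag \<open>X\<close> with \<open>N(C) \<subseteq> X \<subseteq> C \<union> N(C)\<close>, and the components of \<open>C - X\<close> are the next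
  territories. If the set \<open>\<Phi>\<close> of pairs of vertices sharing a bag is chosen minimal, and then the bag
  \<open>X\<close> maximal, then no component \<open>K\<close> of \<open>C - X\<close> is needed to connect \<open>X\<close>: any two vertices of \<open>X\<close>
  are joined in \<open>G - K\<close> (otherwise \<open>X\<close> could be split along \<open>K\<close> and \<open>\<Phi>\<close> would lose a pair).

  To make \<open>X\<close> connected, start from its vertices as singleton blocks and repeatedly join two blocks.
  Suppose a connected set \<open>K\<close> in the unused part of \<open>C\<close> touches a component \<open>F\<^sub>1\<close> of what has been
  joined so far and also the rest. Since these are joined outside \<open>K\<close> too, some cycle meets the cut
  between \<open>K\<close> and \<open>F\<^sub>1\<close> exactly once, so some cycle of length at most \<open>\<ell>\<close> meets it oddly often. Such a
  cycle has a segment through \<open>K\<close> from \<open>F\<^sub>1\<close> to the rest, with at most \<open>\<ell> - 3\<close> inner vertices. At most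
  \<open>\<bar>X\<bar> - 1\<close> such links are needed, so the connected part has at most \<open>1 + (\<bar>X\<bar> - 1)(\<ell> - 2)\<close>
  vertices. The links inside a child territory are handed down to it, where they are subdivided by
  the new bag without losing this count.
\<close>

section \<open>Connected sets and components\<close>

text \<open>The relation is reflexive at every vertex, even outside \<open>W\<close>, so lemmas that
  place a walk inside \<open>W\<close> ask for its start to lie there.\<close>

definition reach :: "'a set set \<Rightarrow> 'a set \<Rightarrow> ('a \<times> 'a) set" where
  "reach E W = {(u, v). u \<in> W \<and> v \<in> W \<and> {u, v} \<in> E}\<^sup>*"

definition connset :: "'a set set \<Rightarrow> 'a set \<Rightarrow> bool" where
  "connset E W \<longleftrightarrow> W \<noteq> {} \<and> (\<forall>u\<in>W. \<forall>v\<in>W. (u, v) \<in> reach E W)"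

definition nbs :: "'a set set \<Rightarrow> 'a set \<Rightarrow> 'a set" where
  "nbs E C = {v. v \<notin> C \<and> (\<exists>u\<in>C. {u, v} \<in> E)}"

definition comps :: "'a set set \<Rightarrow> 'a set \<Rightarrow> 'a set set" where
  "comps E W = {K. connset E K \<and> K \<subseteq> W \<and> nbs E K \<inter> W = {}}"

lemma reach_refl [simp]: "(u, u) \<in> reach E W"
  by (simp add: reach_def)

lemma reach_edge: "\<lbrakk>u \<in> W; v \<in> W; {u, v} \<in> E\<rbrakk> \<Longrightarrow> (u, v) \<in> reach E W"
  by (auto simp: reach_def)

lemma reach_trans: "\<lbrakk>(u, v) \<in> reach E W; (v, w) \<in> reach E W\<rbrakk> \<Longrightarrow> (u, w) \<in> reach E W"
  by (simp add: reach_def)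

lemma reach_sym: "(u, v) \<in> reach E W \<Longrightarrow> (v, u) \<in> reach E W"
  unfolding reach_def
  by (rule symD[OF sym_rtrancl]) (auto simp: sym_def insert_commute)

lemma reach_mono: "\<lbrakk>(u, v) \<in> reach E W; W \<subseteq> W'\<rbrakk> \<Longrightarrow> (u, v) \<in> reach E W'"
  unfolding reach_def by (erule rtrancl_mono[THEN subsetD, rotated]) auto

lemma reach_closed:
  assumes "(u, v) \<in> reach E W" "u \<in> Z" "nbs E Z \<inter> W = {}"
  shows "v \<in> Z"
  using assms(1) unfolding reach_def
proof (induction rule: rtrancl_induct)
  case (step y z)
  then show ?case using assms(3) by (auto simp: nbs_def)
qed (use assms in auto)

lemma reach_in: "\<lbrakk>(u, v) \<in> reach E W; u \<in> W\<rbrakk> \<Longrightarrow> v \<in> W"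
  by (erule reach_closed) (auto simp: nbs_def)

text \<open>A walk inside \<open>L\<close> that starts in \<open>K\<close> cannot leave
  \<open>K\<close>. This is the tool for comparing components taken in different sets.\<close>

lemma connset_subset:
  assumes "connset E L" "L \<inter> K \<noteq> {}" "nbs E K \<inter> L = {}"
  shows "L \<subseteq> K"
  using assms reach_closed unfolding connset_def by (metis disjoint_iff subsetI)

lemma connset_reachI:
  assumes "z \<in> W" "\<And>u. u \<in> W \<Longrightarrow> (z, u) \<in> reach E W"
  shows "connset E W"
  unfolding connset_def using assms reach_sym reach_trans by (metis empty_iff)

lemma connset_nonempty: "connset E W \<Longrightarrow> W \<noteq> {}"
  by (simp add: connset_def)

lemma connset_reach: "\<lbrakk>connset E W; u \<in> W; v \<in> W; W \<subseteq> W'\<rbrakk> \<Longrightarrow> (u, v) \<in> reach E W'"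
  unfolding connset_def using reach_mono by metis

lemma connset_insert_nb:
  assumes "connset E W" "u \<in> W" "{u, v} \<in> E"
  shows "connset E (insert v W)"
proof (rule connset_reachI[of u])
  fix x assume "x \<in> insert v W"
  then show "(u, x) \<in> reach E (insert v W)"
    using assms connset_reach[OF assms(1,2) _ subset_insertI] by (auto intro: reach_edge)
qed (use assms in auto)

lemma connset_Un:
  assumes "connset E A" "connset E B" "A \<inter> B \<noteq> {}"
  shows "connset E (A \<union> B)"
proof -
  obtain z where z: "z \<in> A" "z \<in> B" using assms(3) by auto
  show ?thesis
    using z connset_reach[OF assms(1) z(1) _ Un_upper1] connset_reach[OF assms(2) z(2) _ Un_upper2]
    by (intro connset_reachI[of z]) auto
qed

lemma comps_exists:
  assumes "u \<in> W"
  obtains K where "K \<in> comps E W" "u \<in> K"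
proof -
  define K where "K = {v. (u, v) \<in> reach E W}"
  have KW: "K \<subseteq> W" using assms reach_in by (fastforce simp: K_def)
  have nb: "nbs E K \<inter> W = {}"
  proof -
    have False if "y \<in> K" "{y, v} \<in> E" "v \<notin> K" "v \<in> W" for y v
      using that KW reach_edge[of y W v E] reach_trans[of u y E W v] by (auto simp: K_def)
    then show ?thesis by (auto simp: nbs_def)
  qed
  \<comment> \<open>Walks in \<open>W\<close> from \<open>u\<close> never leave \<open>K\<close>, so
    they are walks in \<open>K\<close>; this makes \<open>K\<close> itself connected.\<close>
  have "(u, v) \<in> reach E K" if "(u, v) \<in> reach E W" for v
    using that unfolding reach_def
  proof (induction rule: rtrancl_induct)
    case (step y z)
    have "y \<in> K" "z \<in> K"
      using step(1,2) unfolding K_def reach_def by (auto intro: rtrancl_into_rtrancl)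
    then show ?case using step by (auto intro: rtrancl_into_rtrancl)
  qed auto
  then have "connset E K"
    by (intro connset_reachI[of u]) (auto simp: K_def)
  with KW nb show ?thesis
    by (intro that[of K]) (auto simp: comps_def K_def)
qed

lemma compsD:
  assumes "K \<in> comps E W"
  shows "connset E K" "K \<subseteq> W" "nbs E K \<inter> W = {}" "K \<noteq> {}"
  using assms by (auto simp: comps_def connset_def)

lemma Union_comps: "\<Union>(comps E W) = W"
  using comps_exists compsD(2) by (metis Sup_le_iff UnionI subsetI subset_antisym)

lemma comps_absorb:
  assumes "K \<in> comps E W" "connset E L" "L \<subseteq> W" "L \<inter> K \<noteq> {}"
  shows "L \<subseteq> K"
  using connset_subset[OF assms(2,4)] assms compsD(3) by blast

lemma comps_absorb_exists:
  assumes "connset E L" "L \<subseteq> W"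
  obtains K where "K \<in> comps E W" "L \<subseteq> K"
proof -
  obtain u where u: "u \<in> L" using assms(1) connset_nonempty by blast
  then obtain K where K: "K \<in> comps E W" "u \<in> K" using comps_exists assms(2) by (metis subsetD)
  then have "L \<subseteq> K" using comps_absorb assms u by (metis disjoint_iff)
  with K that show ?thesis by blast
qed

lemma comps_disjoint:
  assumes "K \<in> comps E W" "K' \<in> comps E W" "K \<noteq> K'"
  shows "K \<inter> K' = {}"
  using assms comps_absorb compsD(1,2) by (metis inf_commute subset_antisym)

lemma comps_nbs: "K \<in> comps E (C - X) \<Longrightarrow> nbs E K \<subseteq> X \<union> nbs E C"
  by (auto simp: comps_def nbs_def)

lemma nbs_subset: "K \<subseteq> C \<Longrightarrow> nbs E K \<subseteq> C \<union> nbs E C"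
  by (auto simp: nbs_def)

section \<open>Walks, paths and reachability\<close>

lemma walk_edges_iff: "walk_edges p \<subseteq> E \<longleftrightarrow> successively (\<lambda>x y. {x, y} \<in> E) p"
  by (induction p rule: walk_edges.induct) auto

lemma walk_edges_vertices: "e \<in> walk_edges p \<Longrightarrow> e \<subseteq> set p"
  by (induction p rule: walk_edges.induct) auto

lemma walk_reach:
  "\<lbrakk>successively (\<lambda>x y. {x, y} \<in> E) p; set p \<subseteq> W; p \<noteq> []\<rbrakk> \<Longrightarrow> (hd p, last p) \<in> reach E W"
proof (induction p rule: walk_edges.induct)
  case (1 x y p)
  then show ?case using reach_edge[of x W y E] by (auto intro: reach_trans)
qed auto

lemma walk_connset:
  assumes "successively (\<lambda>x y. {x, y} \<in> E) p" "p \<noteq> []"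
  shows "connset E (set p)"
proof (rule connset_reachI[of "hd p"])
  fix u assume "u \<in> set p"
  then obtain p1 p2 where p: "p = p1 @ u # p2" by (meson split_list)
  have "(hd (p1 @ [u]), last (p1 @ [u])) \<in> reach E (set p)"
    by (rule walk_reach) (use assms p in \<open>auto simp: successively_append_iff split: if_splits\<close>)
  then show "(hd p, u) \<in> reach E (set p)" using p by (cases p1) auto
qed (use assms in auto)

lemma reach_path:
  assumes "(u, v) \<in> reach E W" "u \<in> W"
  shows "\<exists>p. p \<noteq> [] \<and> hd p = u \<and> last p = v \<and> distinct p \<and> set p \<subseteq> W \<and>
             successively (\<lambda>x y. {x, y} \<in> E) p"
  using assms(1) unfolding reach_def
proof (induction rule: rtrancl_induct)
  case base
  show ?case by (rule exI[of _ "[u]"]) (use assms(2) in auto)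
next
  case (step y z)
  then obtain p where p: "p \<noteq> []" "hd p = u" "last p = y" "distinct p" "set p \<subseteq> W"
    "successively (\<lambda>x y. {x, y} \<in> E) p" by auto
  show ?case
  proof (cases "z \<in> set p")
    \<comment> \<open>If \<open>z\<close> is already on the path, the path is cut off there, which
      keeps its vertices distinct.\<close>
    case True
    then obtain p1 p2 where "p = p1 @ z # p2" by (meson split_list)
    then have "p = (p1 @ [z]) @ p2" by simp
    then have "successively (\<lambda>x y. {x, y} \<in> E) (p1 @ [z])" 
      using p(6) by (metis successively_append_iff)
    moreover have "hd (p1 @ [z]) = u" using p(2) \<open>p = p1 @ z # p2\<close> by (cases p1) auto
    ultimately show ?thesis using p \<open>p = p1 @ z # p2\<close> by (intro exI[of _ "p1 @ [z]"]) auto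
  next
    case False
    then show ?thesis using p step(2)
      by (intro exI[of _ "p @ [z]"]) (auto simp: successively_append_iff)
  qed
qed

lemma connected_graph_iff: "connected_graph T \<longleftrightarrow> connset (edges T) (verts T)"
proof
  assume c: "connected_graph T"
  show "connset (edges T) (verts T)"
    unfolding connset_def
  proof (intro conjI ballI)
    fix u v assume "u \<in> verts T" "v \<in> verts T"
    then obtain p where "is_path_between T u p v" using c by (auto simp: connected_graph_def)
    then show "(u, v) \<in> reach (edges T) (verts T)"
      using walk_reach[of "edges T" p "verts T"]
      by (auto simp: is_path_between_def is_path_def walk_edges_iff)
  qed (use c in \<open>auto simp: connected_graph_def\<close>)
next
  assume c: "connset (edges T) (verts T)"
  show "connected_graph T"
    unfolding connected_graph_def
  proof (intro conjI ballI)
    fix u v assume "u \<in> verts T" "v \<in> verts T"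
    then have "(u, v) \<in> reach (edges T) (verts T)" using c by (auto simp: connset_def)
    from reach_path[OF this \<open>u \<in> verts T\<close>] show "\<exists>p. is_path_between T u p v"
      by (auto simp: is_path_between_def is_path_def walk_edges_iff)
  qed (use c in \<open>auto simp: connset_def\<close>)
qed

lemma connected_in_iff: "connected_in G X \<longleftrightarrow> X \<subseteq> verts G \<and> connset (edges G) X"
proof -
  have "reach {e \<in> edges G. e \<subseteq> X} X = reach (edges G) X"
    unfolding reach_def by (rule arg_cong[of _ _ rtrancl]) auto
  then show ?thesis
    by (simp add: connected_in_def connected_graph_iff induced_subgraph_def connset_def)
qed

section \<open>Recursive decompositions with irreducible bags\<close>

text \<open>
  Every bag has at most \<open>k\<close> vertices and is a clique of \<open>\<Phi>\<close>. The parameter \<open>\<Phi>\<close> is the same in the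
  whole recursion; it exists only to be minimized.
\<close>

inductive win :: "'a set set \<Rightarrow> nat \<Rightarrow> ('a \<times> 'a) set \<Rightarrow> 'a set \<Rightarrow> bool" for E k \<Phi> where
  winI: "\<lbrakk>nbs E C \<subseteq> X; X \<subseteq> C \<union> nbs E C; X \<inter> C \<noteq> {}; card X \<le> k; X \<times> X \<subseteq> \<Phi>;
          \<And>K. K \<in> comps E (C - X) \<Longrightarrow> win E k \<Phi> K\<rbrakk> \<Longrightarrow> win E k \<Phi> C"

text \<open>The premises of the single rule of \<open>win\<close>, named so that different first
  bags of one territory can be compared.\<close>

definition win_bag :: "'a set set \<Rightarrow> nat \<Rightarrow> ('a \<times> 'a) set \<Rightarrow> 'a set \<Rightarrow> 'a set \<Rightarrow> bool" where
  "win_bag E k \<Phi> C X \<longleftrightarrow> nbs E C \<subseteq> X \<and> X \<subseteq> C \<union> nbs E C \<and> X \<inter> C \<noteq> {} \<and> card X \<le> k \<and>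
     X \<times> X \<subseteq> \<Phi> \<and> (\<forall>K\<in>comps E (C - X). win E k \<Phi> K)"

lemma win_iff: "win E k \<Phi> C \<longleftrightarrow> (\<exists>X. win_bag E k \<Phi> C X)"
  unfolding win_bag_def by (subst win.simps) blast

text \<open>All bags of the recursion on \<open>C\<close> lie in \<open>C \<union> nbs E C\<close>,
  so only pairs inside that set matter. Hence a pair can be removed from \<open>\<Phi>\<close> by
  looking at each territory separately.\<close>

lemma win_restrict:
  assumes "win E k \<Phi> C" "\<Phi> \<inter> (C \<union> nbs E C) \<times> (C \<union> nbs E C) \<subseteq> \<Psi>"
  shows "win E k \<Psi> C"
  using assms
proof (induction rule: win.induct)
  case (winI C X)
  show ?case
  proof (rule win.winI[of _ _ X])
    show "X \<times> X \<subseteq> \<Psi>" using winI.hyps winI.prems by blast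
    fix K assume K: "K \<in> comps E (C - X)"
    then have "K \<subseteq> C" using compsD(2) by blast
    then have "K \<union> nbs E K \<subseteq> C \<union> nbs E C" using nbs_subset by blast
    then show "win E k \<Psi> K"
      using winI.prems winI.IH[OF K] by blast
  qed (use winI in auto)
qed

lemma nbs_comp_diff_subset:
  assumes "L \<in> comps E (D - Y)" "nbs E K \<subseteq> Y" "L \<inter> K \<noteq> {}"
  shows "L \<subseteq> K"
  using connset_subset[OF compsD(1)[OF assms(1)] assms(3)] compsD(2)[OF assms(1)] assms(2) by blast

section \<open>Splitting a bag that is joined only through one child\<close>

context
  fixes E :: "'a set set" and V C X K :: "'a set" and k \<Phi> z R
  assumes finX: "finite X" and conn: "connset E C" and CV: "C \<union> nbs E C \<subseteq> V"
    and bag: "win_bag E k \<Phi> C X" and K: "K \<in> comps E (C - X)"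
    and zX: "z \<in> X" and R_def: "R = {v. (z, v) \<in> reach E (V - K)}" and CR: "nbs E C \<subseteq> R"
begin

lemma R_sub: "R \<subseteq> V - K"
proof -
  have "z \<in> V - K" using zX bag CV compsD(2)[OF K] by (auto simp: win_bag_def)
  then show ?thesis unfolding R_def by (auto dest: reach_in)
qed

lemma R_closed: "\<lbrakk>u \<in> R; {u, v} \<in> E; v \<in> V - K\<rbrakk> \<Longrightarrow> v \<in> R"
  using R_sub reach_edge[of u "V - K" v E] by (auto simp: R_def intro: reach_trans)

lemma R_absorb: "\<lbrakk>connset E Q; Q \<subseteq> V - K; Q \<inter> R \<noteq> {}\<rbrakk> \<Longrightarrow> Q \<subseteq> R"
  using connset_reach[of E Q _ _ "V - K"] reach_trans[of z _ E "V - K"] unfolding R_def by blast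

text \<open>A child other than \<open>K\<close> is connected with its neighbours inside
  \<open>V - K\<close>, so one vertex in \<open>R\<close> draws all of them into
  \<open>R\<close>.\<close>

lemma split_child:
  assumes Q: "Q \<in> comps E (C - X)" "Q \<noteq> K"
  shows "Q \<subseteq> V - K" "nbs E Q \<subseteq> X" "nbs E Q \<inter> R \<noteq> {} \<or> Q \<inter> R \<noteq> {} \<Longrightarrow> Q \<subseteq> R \<and> nbs E Q \<subseteq> R"
proof -
  have XVK: "X \<subseteq> V - K" using bag CV compsD(2)[OF K] by (auto simp: win_bag_def)
  show 1: "Q \<subseteq> V - K"
    using comps_disjoint[OF Q(1) K Q(2)] compsD(2)[OF Q(1)] CV by auto
  show 2: "nbs E Q \<subseteq> X"
    using comps_nbs[OF Q(1)] bag by (auto simp: win_bag_def)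
  assume "nbs E Q \<inter> R \<noteq> {} \<or> Q \<inter> R \<noteq> {}"
  then have "Q \<inter> R \<noteq> {}"
  proof
    assume "nbs E Q \<inter> R \<noteq> {}"
    then obtain v q where "v \<in> R" "q \<in> Q" "{q, v} \<in> E" by (auto simp: nbs_def)
    then have "q \<in> R" using R_closed[of v q] 1 by (auto simp: insert_commute)
    with \<open>q \<in> Q\<close> show ?thesis by auto
  qed auto
  then have "Q \<subseteq> R" using R_absorb compsD(1)[OF Q(1)] 1 by blast
  moreover have "nbs E Q \<subseteq> R"
  proof
    fix v assume v: "v \<in> nbs E Q"
    then obtain q where "q \<in> Q" "{q, v} \<in> E" by (auto simp: nbs_def)
    then show "v \<in> R" using R_closed[of q v] \<open>Q \<subseteq> R\<close> v 2 XVK by auto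
  qed
  ultimately show "Q \<subseteq> R \<and> nbs E Q \<subseteq> R" ..
qed

text \<open>Pairs that suffice for the new recursion: those inside either half of \<open>X\<close>,
  and those already allowed in the closed neighbourhood of a child. A pair across the halves is
  demanded only if it lies in such a neighbourhood.\<close>

context
  fixes \<Psi>
  assumes h1: "\<Phi> \<inter> (K \<union> nbs E K) \<times> (K \<union> nbs E K) \<subseteq> \<Psi>"
    and h2: "(X - R) \<times> (X - R) \<subseteq> \<Psi>"
    and h3: "\<And>Q. \<lbrakk>Q \<in> comps E (C - X); Q \<noteq> K\<rbrakk> \<Longrightarrow> \<Phi> \<inter> (Q \<union> nbs E Q) \<times> (Q \<union> nbs E Q) \<subseteq> \<Psi>"
    and h4: "(X \<inter> R) \<times> (X \<inter> R) \<subseteq> \<Psi>"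
begin

lemma win_child: "\<lbrakk>Q \<in> comps E (C - X); Q \<noteq> K\<rbrakk> \<Longrightarrow> win E k \<Psi> Q"
  using bag by (intro win_restrict[OF _ h3]) (auto simp: win_bag_def)

text \<open>
  The bag \<open>X\<close> falls into \<open>X \<inter> R\<close> and \<open>X - R\<close>, joined only through \<open>K\<close>. The new recursion uses the bag
  \<open>X \<inter> R\<close> first, then on the territory containing \<open>K\<close> the bag of \<open>K\<close>, and only afterwards the
  pieces of \<open>X - R\<close>.
\<close>

lemma win_split_comp:
  assumes D: "D \<in> comps E (C - X \<inter> R)" and KD: "K \<subseteq> D"
  shows "win E k \<Psi> D"
proof -
  note b = bag[unfolded win_bag_def]
  have DC: "D \<subseteq> C" using compsD(2)[OF D] by auto
  have KX: "K \<inter> X = {}" using compsD(2)[OF K] by auto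
  have XVK: "X \<subseteq> V - K" using b CV KX by auto
  have DV: "D \<subseteq> V" using DC CV by auto
  have "win E k \<Phi> K" using K b by simp
  then obtain Y where Y: "win_bag E k \<Phi> K Y" by (auto simp: win_iff)
  note y = Y[unfolded win_bag_def]
  \<comment> \<open>Such a \<open>d\<close> in \<open>R\<close> would lie in a child of
    \<open>X\<close> other than \<open>K\<close> with boundary in \<open>X \<inter> R\<close>. Then
    \<open>D\<close> would be inside that child, but \<open>D\<close> contains
    \<open>K\<close>.\<close>
  have key: "d \<notin> R" if d: "d \<in> D" "d \<notin> K" for d
  proof
    assume dR: "d \<in> R"
    have "d \<in> C - X" using d dR compsD(2)[OF D] by auto
    then obtain Q where Q: "Q \<in> comps E (C - X)" "d \<in> Q" using comps_exists by metis
    then have "Q \<noteq> K" using d by auto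
    note q = split_child[OF Q(1) this]
    have "nbs E Q \<subseteq> X \<inter> R" using q(2,3) Q dR by blast
    then have "nbs E Q \<inter> D = {}" using compsD(2)[OF D] by auto
    then have "D \<subseteq> Q" using connset_subset[OF compsD(1)[OF D]] d Q by blast
    then show False using KD comps_disjoint[OF Q(1) K \<open>Q \<noteq> K\<close>] compsD(4)[OF K] by blast
  qed
  have nD: "nbs E D \<subseteq> X \<inter> R" using comps_nbs[OF D] b CR by auto
  \<comment> \<open>A boundary vertex of \<open>D\<close> lies in \<open>R\<close>, so a neighbour
    of it in \<open>D - K\<close> would lie in \<open>R\<close> too. Hence it is adjacent to
    \<open>K\<close> and belongs to \<open>Y\<close>.\<close>
  have nDY: "nbs E D \<subseteq> Y"
  proof
    fix v assume v: "v \<in> nbs E D"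
    then obtain d where d: "d \<in> D" "{d, v} \<in> E" by (auto simp: nbs_def)
    have "v \<in> X \<inter> R" using nD v by auto
    show "v \<in> Y"
    proof (cases "d \<in> K")
      case True
      then have "v \<in> nbs E K" using d \<open>v \<in> X \<inter> R\<close> KX by (auto simp: nbs_def)
      then show ?thesis using y by auto
    next
      case False
      then have "d \<in> R" using R_closed[of v d] d \<open>v \<in> X \<inter> R\<close> DV by (auto simp: insert_commute)
      then show ?thesis using key d False by auto
    qed
  qed
  show ?thesis
  proof (rule winI[of _ _ Y])
    show "nbs E D \<subseteq> Y" by fact
    show "Y \<subseteq> D \<union> nbs E D" using y KD nbs_subset[OF KD] by blast
    show "Y \<inter> D \<noteq> {}" using y KD by auto
    show "card Y \<le> k" using y by auto
    have YK: "Y \<subseteq> K \<union> nbs E K" using y by simp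
    have "Y \<times> Y \<subseteq> \<Phi> \<inter> (K \<union> nbs E K) \<times> (K \<union> nbs E K)"
      using y Sigma_mono[OF YK YK] by simp
    then show "Y \<times> Y \<subseteq> \<Psi>" using h1 by (rule order_trans)
    fix L assume L: "L \<in> comps E (D - Y)"
    show "win E k \<Psi> L"
    proof (cases "L \<inter> K = {}")
      case False
      then have LK: "L \<subseteq> K" using nbs_comp_diff_subset L y by metis
      have "L \<in> comps E (K - Y)" using L LK KD by (auto simp: comps_def)
      then have "win E k \<Phi> L" using y by blast
      have LKn: "L \<union> nbs E L \<subseteq> K \<union> nbs E K" using LK nbs_subset[OF LK, of E] by auto
      have "\<Phi> \<inter> (L \<union> nbs E L) \<times> (L \<union> nbs E L) \<subseteq> \<Psi>"
        using h1 Sigma_mono[OF LKn LKn] by auto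
      with \<open>win E k \<Phi> L\<close> show ?thesis by (rule win_restrict)
    next
      \<comment> \<open>What \<open>D - Y\<close> has outside \<open>K\<close> avoids
        \<open>R\<close> and has its boundary in \<open>X - R\<close>. The next bag is what
        \<open>X\<close> has in \<open>L\<close> and its boundary; the children left over are
        children of \<open>X\<close> other than \<open>K\<close>.\<close>
      case True
      have LD: "L \<subseteq> D" "L \<inter> Y = {}" using compsD(2)[OF L] by auto
      have LR: "L \<inter> R = {}" using key LD True by auto
      have nLY: "nbs E L \<subseteq> Y" using comps_nbs[OF L] nDY by auto
      have "nbs E L \<inter> K = {}"
      proof -
        have False if v: "v \<in> nbs E L" "v \<in> K" for v
        proof -
          obtain l where "l \<in> L" "{l, v} \<in> E" using v by (auto simp: nbs_def)
          then have "l \<in> nbs E K" using v True by (auto simp: nbs_def insert_commute)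
          then show False using y LD \<open>l \<in> L\<close> by auto
        qed
        then show ?thesis by auto
      qed
      moreover have "nbs E K \<subseteq> X" using comps_nbs[OF K] b by auto
      ultimately have nLX: "nbs E L \<subseteq> X" using nLY y by auto
      have "nbs E L \<inter> R = {}"
      proof -
        have False if v: "v \<in> nbs E L" "v \<in> R" for v
        proof -
          obtain l where l: "l \<in> L" "{l, v} \<in> E" using v by (auto simp: nbs_def)
          then have "l \<in> R" using R_closed[of v l] v True LD DV by (auto simp: insert_commute)
          then show False using LR l by auto
        qed
        then show ?thesis by auto
      qed
      then have nL: "nbs E L \<subseteq> X - R" using nLX by auto
      have Qchild: "Q \<in> comps E (C - X) \<and> Q \<noteq> K" if Q: "Q \<in> comps E (L - X)" for Q
      proof -
        have "Q \<subseteq> L" "Q \<noteq> {}" using compsD[OF Q] by auto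
        moreover have "nbs E Q \<subseteq> X \<union> nbs E L" using comps_nbs[OF Q] .
        ultimately show ?thesis using Q nLX LD DC True by (auto simp: comps_def)
      qed
      show ?thesis
      proof (cases "X \<inter> L = {}")
        \<comment> \<open>A bag must meet its territory. Here \<open>X\<close> misses
          \<open>L\<close>, and \<open>L\<close> is already a child of \<open>X\<close>.\<close>
        case True
        then have "L - X = L" by auto
        moreover have "L \<in> comps E L" using compsD(1)[OF L] by (auto simp: comps_def nbs_def)
        ultimately show ?thesis using Qchild win_child by metis
      next
        case False
        show ?thesis
        proof (rule winI[of _ _ "X \<inter> (L \<union> nbs E L)"])
          show "card (X \<inter> (L \<union> nbs E L)) \<le> k"
            using card_mono[OF finX, of "X \<inter> (L \<union> nbs E L)"] b by auto
          have XL: "X \<inter> (L \<union> nbs E L) \<subseteq> X - R" using LR nL by auto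
          show "(X \<inter> (L \<union> nbs E L)) \<times> (X \<inter> (L \<union> nbs E L)) \<subseteq> \<Psi>"
            using h2 Sigma_mono[OF XL XL] by (rule order_trans[rotated])
          fix Q assume "Q \<in> comps E (L - X \<inter> (L \<union> nbs E L))"
          moreover have "L - X \<inter> (L \<union> nbs E L) = L - X" by auto
          ultimately show "win E k \<Psi> Q" using Qchild win_child by metis
        qed (use False nLX in auto)
      qed
    qed
  qed
qed

lemma win_split: "win E k \<Psi> C"
proof (cases "X \<inter> R \<inter> C = {}")
  \<comment> \<open>\<open>X \<inter> R\<close> misses \<open>C\<close> and cannot be its bag, but
    then \<open>C\<close> itself is the component of \<open>C - X \<inter> R\<close> that contains
    \<open>K\<close>.\<close>
  case True
  then have "C - X \<inter> R = C" by auto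
  then have "C \<in> comps E (C - X \<inter> R)" using conn by (auto simp: comps_def nbs_def)
  then show ?thesis using win_split_comp compsD(2)[OF K] by blast
next
  case False
  note b = bag[unfolded win_bag_def]
  show ?thesis
  proof (rule winI[of _ _ "X \<inter> R"])
    show "card (X \<inter> R) \<le> k" using card_mono[OF finX, of "X \<inter> R"] b by auto
    show "(X \<inter> R) \<times> (X \<inter> R) \<subseteq> \<Psi>" by fact
    fix D assume D: "D \<in> comps E (C - X \<inter> R)"
    show "win E k \<Psi> D"
    proof (cases "D \<inter> K = {}")
      case False
      have "K \<subseteq> D"
        by (rule comps_absorb[OF D compsD(1)[OF K]]) (use compsD(2)[OF K] False in auto)
      then show ?thesis using win_split_comp D by blast
    next
      case True
      have DC: "D \<subseteq> C" using compsD(2)[OF D] by auto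
      have nD: "nbs E D \<subseteq> X \<inter> R" using comps_nbs[OF D] b CR by auto
      have DV: "D \<subseteq> V - K" using DC CV True by auto
      \<comment> \<open>Otherwise \<open>D\<close> would be all of the connected set
        \<open>C\<close>, although \<open>X \<inter> R\<close> has a vertex in
        \<open>C\<close>.\<close>
      have "nbs E D \<noteq> {}"
      proof
        assume "nbs E D = {}"
        then have "C \<subseteq> D" using connset_subset[OF conn] DC compsD(4)[OF D] by blast
        then show False using False compsD(2)[OF D] by auto
      qed
      then obtain v where v: "v \<in> nbs E D" by auto
      then obtain d where d: "d \<in> D" "{d, v} \<in> E" by (auto simp: nbs_def)
      then have "d \<in> R" using R_closed[of v d] nD v DV by (auto simp: insert_commute)
      then have "D \<subseteq> R" using R_absorb[OF compsD(1)[OF D] DV] d by blast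
      then have "D \<in> comps E (C - X)" using D nD by (auto simp: comps_def)
      moreover have "D \<noteq> K" using True compsD(4)[OF K] by auto
      ultimately show ?thesis by (rule win_child)
    qed
  qed (use b CR False in auto)
qed

end

end

section \<open>Extremal choice of pairs and bag\<close>

text \<open>Since \<open>Y\<close> contains \<open>X = nbs E K\<close>, a component of
  \<open>C - Y\<close> either lies in \<open>K\<close> and is a child of \<open>Y\<close>, or is
  already a child of \<open>X\<close>. So \<open>Y\<close> may replace \<open>X\<close>.\<close>

lemma win_bag_absorb:
  assumes bag: "win_bag E k \<Phi> C X" and K: "K \<in> comps E (C - X)" and XK: "X = nbs E K"
    and Y: "win_bag E k \<Phi> K Y"
  shows "win_bag E k \<Phi> C Y"
proof -
  note b = bag[unfolded win_bag_def] and y = Y[unfolded win_bag_def]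
  have KC: "K \<subseteq> C" using compsD(2)[OF K] by auto
  have "win E k \<Phi> L" if L: "L \<in> comps E (C - Y)" for L
  proof (cases "L \<inter> K = {}")
    case False
    then have LK: "L \<subseteq> K" using nbs_comp_diff_subset L y by metis
    then have "L \<in> comps E (K - Y)" using L KC by (auto simp: comps_def)
    then show ?thesis using y by blast
  next
    case True
    have "v \<notin> C - X" if v: "v \<in> nbs E L" for v
    proof
      assume "v \<in> C - X"
      then have "v \<in> K" using v L y XK by (auto simp: comps_def)
      obtain l where l: "l \<in> L" "{l, v} \<in> E" using v by (auto simp: nbs_def)
      then have "l \<in> nbs E K" using \<open>v \<in> K\<close> True by (auto simp: nbs_def insert_commute)
      then show False using y l compsD(2)[OF L] by auto
    qed
    then have "L \<in> comps E (C - X)" using L y XK by (auto simp: comps_def)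
    then show ?thesis using b by blast
  qed
  moreover have "Y \<subseteq> C \<union> nbs E C" using y KC nbs_subset[OF KC, of E] by auto
  moreover have "nbs E C \<subseteq> Y" "Y \<inter> C \<noteq> {}" using y b XK KC by auto
  ultimately show ?thesis unfolding win_bag_def using y by simp
qed

text \<open>\<open>\<Phi>\<close> has the fewest pairs, then \<open>X\<close> the most vertices.
  Suppose \<open>X\<close> is joined only through a child \<open>K\<close>. If
  \<open>X = nbs E K\<close>, the bag of \<open>K\<close> is larger and may replace
  \<open>X\<close>; otherwise a vertex of \<open>X\<close> not adjacent to \<open>K\<close> yields a
  pair that \<open>win_split\<close> can spare. The hypothesis \<open>joined\<close> keeps the whole
  boundary on one side of the split.\<close>

lemma win_irreducible_bag:
  assumes win: "win E k \<Phi>0 C" and finV: "finite V" and CV: "C \<union> nbs E C \<subseteq> V"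
    and conn: "connset E C"
    and joined: "\<And>x y. \<lbrakk>x \<in> nbs E C; y \<in> nbs E C\<rbrakk> \<Longrightarrow> (x, y) \<in> reach E (V - C)"
  shows "\<exists>\<Phi> X. win_bag E k \<Phi> C X \<and>
    (\<forall>K\<in>comps E (C - X). \<forall>x\<in>X. \<forall>y\<in>X. (x, y) \<in> reach E (V - K))"
proof -
  \<comment> \<open>Cutting \<open>\<Phi>0\<close> down to the closed neighbourhood makes it finite,
    so that its cardinality can be minimized.\<close>
  have "finite (\<Phi>0 \<inter> (C \<union> nbs E C) \<times> (C \<union> nbs E C)) \<and>
        win E k (\<Phi>0 \<inter> (C \<union> nbs E C) \<times> (C \<union> nbs E C)) C"
    using win_restrict[OF win order_refl] finite_subset[OF CV finV] by auto
  then obtain \<Phi> where \<Phi>: "finite \<Phi>" "win E k \<Phi> C"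
    and min: "\<And>\<Psi>. \<lbrakk>finite \<Psi>; win E k \<Psi> C\<rbrakk> \<Longrightarrow> card \<Phi> \<le> card \<Psi>"
    using ex_has_least_nat[where P = "\<lambda>\<Psi>. finite \<Psi> \<and> win E k \<Psi> C" and m = card] by metis
  obtain X0 where "win_bag E k \<Phi> C X0" using \<Phi>(2) win_iff by metis
  then obtain X where X: "win_bag E k \<Phi> C X"
    and max: "\<And>Y. win_bag E k \<Phi> C Y \<Longrightarrow> card Y \<le> card X"
    using ex_has_greatest_nat[of "win_bag E k \<Phi> C" X0 card "Suc k"]
    by (auto simp: win_bag_def le_imp_less_Suc)
  note b = X[unfolded win_bag_def]
  have XV: "X \<subseteq> V" using b CV by auto
  have finX: "finite X" using finite_subset[OF XV finV] .
  have "(x0, y0) \<in> reach E (V - K)" if K: "K \<in> comps E (C - X)" and xy: "x0 \<in> X" "y0 \<in> X" for K x0 y0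
  proof (rule ccontr)
    assume not: "(x0, y0) \<notin> reach E (V - K)"
    have KC: "K \<subseteq> C" "K \<inter> X = {}" using compsD(2)[OF K] by auto
    \<comment> \<open>\<open>z\<close> is a boundary vertex if there is one, so that
      \<open>R\<close> contains all of \<open>nbs E C\<close>.\<close>
    define z where "z = (if nbs E C = {} then x0 else (SOME s. s \<in> nbs E C))"
    have z: "z \<in> nbs E C" if "nbs E C \<noteq> {}"
      using that by (auto simp: z_def some_in_eq)
    have zX: "z \<in> X" using b xy z by (cases "nbs E C = {}") (auto simp: z_def)
    define R where "R = {v. (z, v) \<in> reach E (V - K)}"
    have CR: "nbs E C \<subseteq> R"
    proof
      fix s assume "s \<in> nbs E C"
      then have "(z, s) \<in> reach E (V - C)" using z joined by blast
      then show "s \<in> R" using reach_mono[of _ _ E "V - C" "V - K"] KC by (auto simp: R_def)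
    qed
    have zR: "z \<in> R" by (simp add: R_def)
    have "\<not> (x0 \<in> R \<and> y0 \<in> R)"
      using not reach_trans[OF reach_sym, of z x0 E "V - K" y0] by (auto simp: R_def)
    then obtain w where w: "w \<in> X - R" using xy by auto
    note ctx = finX conn CV X K zX R_def CR
    have "X \<noteq> nbs E K"
    proof
      assume XK: "X = nbs E K"
      have "win E k \<Phi> K" using K b by simp
  then obtain Y where Y: "win_bag E k \<Phi> K Y" by (auto simp: win_iff)
      then have "win_bag E k \<Phi> C Y" using win_bag_absorb X K XK by metis
      moreover have "X \<subset> Y" using Y XK KC by (auto simp: win_bag_def)
      moreover have "finite Y"
        using finite_subset[OF _ finV, of Y] CV \<open>win_bag E k \<Phi> C Y\<close> by (auto simp: win_bag_def)
      ultimately show False using max[of Y] psubset_card_mono[of Y X] by auto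
    qed
    moreover have "nbs E K \<subseteq> X" using comps_nbs[OF K] b by auto
    ultimately obtain x where x: "x \<in> X" "x \<notin> nbs E K" by auto
    \<comment> \<open>\<open>x\<close> is not adjacent to \<open>K\<close> and \<open>x'\<close>
      lies on the other side of \<open>R\<close>, so no closed neighbourhood of a child contains
      both.\<close>
    obtain x' where x': "x' \<in> X" "x \<in> R \<longleftrightarrow> x' \<notin> R" using w zX zR by (cases "x \<in> R") auto
    have "win E k (\<Phi> - {(x, x')}) C"
    proof (rule win_split[OF ctx])
      show "\<Phi> \<inter> (K \<union> nbs E K) \<times> (K \<union> nbs E K) \<subseteq> \<Phi> - {(x, x')}" using x KC by auto
      show "(X - R) \<times> (X - R) \<subseteq> \<Phi> - {(x, x')}" "(X \<inter> R) \<times> (X \<inter> R) \<subseteq> \<Phi> - {(x, x')}"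
        using b x' by auto
      fix Q assume Q: "Q \<in> comps E (C - X)" "Q \<noteq> K"
      have "Q \<inter> X = {}" using compsD(2)[OF Q(1)] by auto
      then have "\<not> (x \<in> Q \<union> nbs E Q \<and> x' \<in> Q \<union> nbs E Q)"
        using split_child(3)[OF ctx Q] x x' by auto
      then show "\<Phi> \<inter> (Q \<union> nbs E Q) \<times> (Q \<union> nbs E Q) \<subseteq> \<Phi> - {(x, x')}" by auto
    qed
    moreover have "(x, x') \<in> \<Phi>" using b x x' by auto
    ultimately show False using min[of "\<Phi> - {(x, x')}"] \<Phi>(1) card_Diff1_less[of \<Phi> "(x, x')"] by auto
  qed
  with X show ?thesis by blast
qed

section \<open>Short links from the cycle space\<close>

text \<open>Defined on lists so that a closed walk can be cut and rotated. The values of interest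
  are in \<open>bit\<close>.\<close>

fun walk_sum :: "('a set \<Rightarrow> 'b::comm_monoid_add) \<Rightarrow> 'a list \<Rightarrow> 'b" where
  "walk_sum \<chi> (x # y # p) = \<chi> {x, y} + walk_sum \<chi> (y # p)"
| "walk_sum \<chi> _ = 0"

lemma walk_sum_append:
  "walk_sum \<chi> (xs @ y # ys) = walk_sum \<chi> (xs @ [y]) + walk_sum \<chi> (y # ys)"
proof (induction xs)
  case (Cons a xs)
  then show ?case by (cases xs) (auto simp: add.assoc)
qed simp

lemma successively_split:
  "successively P (xs @ y # ys) \<longleftrightarrow> successively P (xs @ [y]) \<and> successively P (y # ys)"
proof (induction xs)
  case (Cons a xs)
  then show ?case by (cases xs) auto
qed simp

lemma finite_walk_edges [simp]: "finite (walk_edges p)"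
  by (induction p rule: walk_edges.induct) auto

lemma sum_walk_edges: "distinct p \<Longrightarrow> sum \<chi> (walk_edges p) = walk_sum \<chi> p"
proof (induction p rule: walk_edges.induct)
  case (1 x y p)
  have "{x, y} \<notin> walk_edges (y # p)"
    using walk_edges_vertices[of "{x, y}" "y # p"] 1(2) by auto
  then show ?case using 1 by simp
qed auto

text \<open>With only two vertices, the closing edge would repeat the only edge of the walk.\<close>

lemma closing_edge:
  assumes "distinct c" "length c \<ge> 3"
  shows "{last c, hd c} \<notin> walk_edges c"
proof -
  obtain x y z r where c: "c = x # y # z # r"
    using assms(2) by (metis Suc_le_length_iff numeral_3_eq_3)
  have "last c \<in> set (z # r)" using c by simp
  then have "last c \<noteq> y" "last c \<noteq> x" using assms(1) c by auto
  moreover have "{last c, x} \<notin> walk_edges (y # z # r)"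
    using walk_edges_vertices[of "{last c, x}" "y # z # r"] assms(1) c by auto
  ultimately show ?thesis using c by (auto simp: doubleton_eq_iff)
qed

lemma sum_cycle_edges:
  assumes "distinct c" "length c \<ge> 3"
  shows "sum \<chi> (cycle_edges c) = walk_sum \<chi> (c @ [hd c])"
proof -
  have "c \<noteq> []" using assms(2) by auto
  then have "c @ [hd c] = butlast c @ last c # [hd c]" by (cases c rule: rev_cases) auto
  then have "walk_sum \<chi> (c @ [hd c]) = walk_sum \<chi> (butlast c @ last c # [hd c])"
    by (rule arg_cong)
  also have "\<dots> = walk_sum \<chi> c + \<chi> {last c, hd c}"
    using \<open>c \<noteq> []\<close> by (simp add: walk_sum_append)
  finally show ?thesis
    using closing_edge[OF assms] sum_walk_edges[OF assms(1), of \<chi>]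
    by (simp add: cycle_edges_def add.commute)
qed

lemma cycle_walk:
  assumes "is_cycle G c"
  shows "successively (\<lambda>x y. {x, y} \<in> edges G) (c @ [hd c])"
  using assms by (auto simp: is_cycle_def cycle_edges_def successively_append_iff walk_edges_iff)

text \<open>The start moves to \<open>f\<close> by swapping the two arcs of the closed walk;
  commutativity of addition preserves the weight.\<close>

lemma cycle_rotate:
  assumes c: "is_cycle G c" and f: "f \<in> set c"
  shows "\<exists>r. distinct (f # r) \<and> Suc (length r) = length c \<and>
    successively (\<lambda>x y. {x, y} \<in> edges G) (f # r @ [f]) \<and>
    walk_sum \<chi> (f # r @ [f]) = walk_sum \<chi> (c @ [hd c])"
proof -
  obtain c1 c2 where c12: "c = c1 @ f # c2" using f by (meson split_list)
  have dist: "distinct c" using c by (auto simp: is_cycle_def)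
  show ?thesis
  proof (cases c1)
    case Nil
    then show ?thesis using c12 cycle_walk[OF c] dist by (intro exI[of _ c2]) simp
  next
    case (Cons h c1')
    have eq: "c @ [hd c] = (h # c1') @ f # (c2 @ [h])" using c12 Cons by simp
    have eq': "f # (c2 @ c1) @ [f] = (f # c2) @ h # (c1' @ [f])" using Cons by simp
    have "walk_sum \<chi> (f # (c2 @ c1) @ [f]) = walk_sum \<chi> (c @ [hd c])"
      unfolding eq eq' walk_sum_append[of _ "h # c1'" f "c2 @ [h]"]
        walk_sum_append[of _ "f # c2" h "c1' @ [f]"]
      by (simp only: append_Cons add.commute)
    moreover have "successively (\<lambda>x y. {x, y} \<in> edges G) (f # (c2 @ c1) @ [f])"
      using cycle_walk[OF c] unfolding eq eq' successively_split[of _ "h # c1'" f "c2 @ [h]"]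
        successively_split[of _ "f # c2" h "c1' @ [f]"]
      by simp
    ultimately show ?thesis using dist c12 by (intro exI[of _ "c2 @ c1"]) auto
  qed
qed

section \<open>Parity of crossings of a cut\<close>

definition cross_edges :: "'a set \<Rightarrow> 'a set \<Rightarrow> 'a set set" where
  "cross_edges F K = {{x, y} | x y. x \<in> F \<and> y \<in> K}"

text \<open>The characteristic function of the cut with values in \<open>bit\<close>, so that a sum
  along a walk is the parity of its crossings.\<close>

abbreviation cross :: "'a set \<Rightarrow> 'a set \<Rightarrow> 'a set \<Rightarrow> bit" where
  "cross F K \<equiv> (\<lambda>e. of_bool (e \<in> cross_edges F K))"

context
  fixes F K :: "'a set"
  assumes FK: "F \<inter> K = {}"
begin

lemma cross_outside: "\<lbrakk>x \<notin> K; y \<notin> K\<rbrakk> \<Longrightarrow> cross F K {x, y} = 0"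
  by (auto simp: cross_edges_def doubleton_eq_iff)

lemma cross_inside: "\<lbrakk>x \<in> K; y \<in> K\<rbrakk> \<Longrightarrow> cross F K {x, y} = 0"
  using FK by (auto simp: cross_edges_def doubleton_eq_iff)

lemma cross_boundary: "\<lbrakk>x \<notin> K; y \<in> K\<rbrakk> \<Longrightarrow> cross F K {x, y} = of_bool (x \<in> F)"
  using FK by (auto simp: cross_edges_def doubleton_eq_iff)

lemma walk_sum_outside: "set p \<inter> K = {} \<Longrightarrow> walk_sum (cross F K) p = 0"
  by (induction p rule: walk_edges.induct) (simp_all add: cross_outside)

lemma walk_sum_inside: "set p \<subseteq> K \<Longrightarrow> walk_sum (cross F K) p = 0"
  by (induction p rule: walk_edges.induct) (simp_all add: cross_inside)

lemma walk_sum_exit: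
  assumes "set q \<subseteq> K" "q \<noteq> []" "b \<notin> K"
  shows "walk_sum (cross F K) (q @ [b]) = of_bool (b \<in> F)"
proof -
  have "q @ [b] = butlast q @ last q # [b]" using assms(2) by (cases q rule: rev_cases) auto
  then have "walk_sum (cross F K) (q @ [b]) = walk_sum (cross F K) (butlast q @ last q # [b])"
    by (rule arg_cong)
  also have "\<dots> = walk_sum (cross F K) q + cross F K {b, last q}"
    using assms(2) by (simp add: walk_sum_append insert_commute)
  finally show ?thesis
    using walk_sum_inside[OF assms(1)] cross_boundary[OF assms(3), of "last q"] assms(1)
      last_in_set[OF assms(2)] by auto
qed

text \<open>A maximal passage through \<open>K\<close>, entered from \<open>a\<close> and left
  towards \<open>b\<close>, contributes the parity of the number of its ends in \<open>F\<close>. A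
  nonzero sum forces a passage with exactly one end in \<open>F\<close>.\<close>

lemma walk_segment:
  assumes "w \<noteq> []" "hd w \<notin> K" "last w \<notin> K" "walk_sum (cross F K) w \<noteq> 0"
  shows "\<exists>u a q b v. w = u @ a # q @ b # v \<and> q \<noteq> [] \<and> set q \<subseteq> K \<and> a \<notin> K \<and> b \<notin> K \<and> (a \<in> F) \<noteq> (b \<in> F)"
  using assms
proof (induction "length w" arbitrary: w rule: less_induct)
  case less
  obtain a y r where w: "w = a # y # r"
    using less.prems by (cases w rule: walk_edges.cases) auto
  show ?case
  proof (cases "y \<in> K")
    case False
    then have "walk_sum (cross F K) (y # r) \<noteq> 0"
      using less.prems cross_outside[of a y] w by simp
    then have "\<exists>u a q b v. y # r = u @ a # q @ b # v \<and> q \<noteq> [] \<and> set q \<subseteq> K \<and> a \<notin> K \<and> b \<notin> K \<and>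
        (a \<in> F) \<noteq> (b \<in> F)"
      by (intro less.hyps) (use less.prems w False in auto)
    then show ?thesis using w append_Cons by metis
  next
    case True
    define q where "q = takeWhile (\<lambda>x. x \<in> K) (y # r)"
    have "last (y # r) \<in> set (y # r)" "last (y # r) \<notin> K" using less.prems(3) w by simp_all
    then have "dropWhile (\<lambda>x. x \<in> K) (y # r) \<noteq> []" by (metis dropWhile_eq_Nil_conv)
    then obtain b v where bv: "dropWhile (\<lambda>x. x \<in> K) (y # r) = b # v" by (meson neq_Nil_conv)
    have yr: "y # r = q @ b # v" using bv takeWhile_dropWhile_id q_def by metis
    have b: "b \<notin> K" using bv hd_dropWhile[of "\<lambda>x. x \<in> K" "y # r"] by auto
    have q: "q \<noteq> []" "set q \<subseteq> K" "hd q = y"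
      using True by (auto simp: q_def dest: set_takeWhileD)
    have a: "a \<notin> K" using less.prems w by simp
    have "walk_sum (cross F K) w = cross F K {a, y} + walk_sum (cross F K) (q @ b # v)"
      by (simp only: w walk_sum.simps flip: yr)
    also have "\<dots> = of_bool (a \<in> F) + of_bool (b \<in> F) + walk_sum (cross F K) (b # v)"
      by (simp only: cross_boundary[OF a True] walk_sum_exit[OF q(2,1) b] walk_sum_append[of _ q b v] add.assoc)
    finally have sum: "walk_sum (cross F K) w = \<dots>" .
    have wq: "w = [] @ a # q @ b # v" using w yr by simp
    show ?thesis
    proof (cases "(a \<in> F) = (b \<in> F)")
      case False
      then show ?thesis using wq q a b by blast
    next
      case True
      \<comment> \<open>The contributions of the two ends cancel modulo 2, so the search goes on
        from \<open>b\<close>.\<close>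
      then have "walk_sum (cross F K) (b # v) \<noteq> 0" using sum less.prems(4) by auto
      then have "\<exists>u a q b' v'. b # v = u @ a # q @ b' # v' \<and> q \<noteq> [] \<and> set q \<subseteq> K \<and> a \<notin> K \<and> b' \<notin> K \<and>
          (a \<in> F) \<noteq> (b' \<in> F)"
        by (intro less.hyps) (use less.prems wq b in auto)
      moreover have "w = (a # q) @ b # v" using wq by simp
      ultimately show ?thesis by (metis append.assoc)
    qed
  qed
qed

text \<open>The cycle is opened at a vertex outside \<open>K\<close> and read as a closed walk; an
  odd passage through \<open>K\<close> is the required segment. The nonadjacency hypothesis forces
  the cycle to be longer than this segment.\<close>

lemma cycle_segment:
  assumes c: "is_cycle G c" and odd: "sum (cross F K) (cycle_edges c) \<noteq> 0"
    and nonadj: "\<And>a b. \<lbrakk>a \<in> F; b \<in> nbs (edges G) K - F\<rbrakk> \<Longrightarrow> {a, b} \<notin> edges G"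
  shows "\<exists>a\<in>F. \<exists>b\<in>nbs (edges G) K - F. \<exists>q. distinct q \<and> set q \<subseteq> K \<and> length q + 3 \<le> length c \<and>
           successively (\<lambda>x y. {x, y} \<in> edges G) (a # q @ [b])"
proof -
  let ?adj = "\<lambda>x y. {x, y} \<in> edges G"
  have dist: "distinct c" and len: "length c \<ge> 3" using c by (auto simp: is_cycle_def)
  have odd': "walk_sum (cross F K) (c @ [hd c]) \<noteq> 0" using sum_cycle_edges[OF dist len, of "cross F K"] odd by simp
  have "\<not> set (c @ [hd c]) \<subseteq> K" using odd' walk_sum_inside by metis
  moreover have "hd c \<in> set c" using len by (intro hd_in_set) auto
  ultimately obtain f where f: "f \<in> set c" "f \<notin> K" by auto
  obtain r where r: "distinct (f # r)" "Suc (length r) = length c"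
    "successively ?adj (f # r @ [f])" "walk_sum (cross F K) (f # r @ [f]) \<noteq> 0"
    using cycle_rotate[OF c f(1), of "cross F K"] odd' by auto
  define w where "w = f # r @ [f]"
  have walk: "successively ?adj w" and wsum: "walk_sum (cross F K) w \<noteq> 0"
    unfolding w_def using r by auto
  obtain u a q b v where w: "w = u @ a # q @ b # v" and q: "q \<noteq> []" "set q \<subseteq> K"
    and ab: "a \<notin> K" "b \<notin> K" "(a \<in> F) \<noteq> (b \<in> F)"
  proof -
    have "w \<noteq> []" "hd w \<notin> K" "last w \<notin> K" using f by (auto simp: w_def)
    from walk_segment[OF this wsum] show ?thesis using that by blast
  qed
  have lw: "length w = length c + 1" using r by (simp add: w_def)
  have seg: "successively ?adj (a # q @ [b])"
    using walk unfolding w successively_split[of _ u a "q @ b # v"]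
      successively_split[of _ "a # q" b v, unfolded append_Cons] by simp
  have dq: "distinct q"
  proof -
    have "distinct (tl w)" using r by (auto simp: w_def)
    then show ?thesis unfolding w by (cases u) auto
  qed
  have nb: "a \<in> nbs (edges G) K" "b \<in> nbs (edges G) K"
  proof -
    have "{a, hd q} \<in> edges G" "{last q, b} \<in> edges G"
      using seg q(1) by (auto simp: successively_append_iff successively_Cons)
    moreover have "hd q \<in> K" "last q \<in> K" using q by auto
    ultimately show "a \<in> nbs (edges G) K" "b \<in> nbs (edges G) K"
      using ab by (auto simp: nbs_def insert_commute)
  qed
  have "{a, b} \<notin> edges G"
    using nonadj[of a b] nonadj[of b a] nb ab(3) by (auto simp: insert_commute)
  have "hd w = last w" by (simp add: w_def)
  \<comment> \<open>With fewer than two entries of \<open>w\<close> outside the segment,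
    \<open>a\<close> and \<open>b\<close> would be equal or adjacent. As \<open>w\<close> repeats
    its first vertex and has length \<open>length c + 1\<close>, this gives the \<open>3\<close> in
    \<open>length q + 3\<close>.\<close>
  have "length u + length v \<ge> 2"
  proof (rule ccontr)
    assume "\<not> ?thesis"
    then consider "u = []" "v = []" | x where "u = [x]" "v = []" | y where "u = []" "v = [y]"
      by (cases u; cases v) (auto simp: not_le less_Suc_eq_0_disj)
    then show False
    proof cases
      case 1
      then show False using \<open>hd w = last w\<close> ab w by auto
    next
      case 2
      then show False using \<open>hd w = last w\<close> walk \<open>{a, b} \<notin> edges G\<close> w by (auto simp: insert_commute)
    next
      case 3
      then show False using \<open>hd w = last w\<close> walk \<open>{a, b} \<notin> edges G\<close> w
        by (auto simp: insert_commute successively_append_iff successively_Cons)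
    qed
  qed
  then have "length q + 3 \<le> length c" using lw w by simp
  show ?thesis
  proof (cases "a \<in> F")
    case True
    then show ?thesis using seg dq q nb ab \<open>length q + 3 \<le> length c\<close> by blast
  next
    case False
    have "successively ?adj (rev (a # q @ [b]))"
      unfolding successively_rev using seg by (simp add: insert_commute)
    then have "successively ?adj (b # rev q @ [a])" by simp
    then show ?thesis using dq q nb ab \<open>length q + 3 \<le> length c\<close> False
      by (intro bexI[of _ b] bexI[of _ a] exI[of _ "rev q"]) auto
  qed
qed

end

section \<open>Odd short cycles and the links they contain\<close>

text \<open>The vectors with sum zero on \<open>D\<close> form a subspace. If it contained all
  cycles of length at most \<open>l\<close>, it would contain the cycle space and with it
  \<open>c\<close>.\<close>

lemma odd_short_cycle:
  assumes gen: "cycles_generate G l" and fin: "finite D"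
    and c: "is_cycle G c" and odd: "(\<Sum>e\<in>cycle_edges c. of_bool (e \<in> D)) \<noteq> (0 :: bit)"
  shows "\<exists>c'. is_cycle G c' \<and> length c' \<le> l \<and> (\<Sum>e\<in>cycle_edges c'. of_bool (e \<in> D)) \<noteq> (0 :: bit)"
proof (rule ccontr)
  assume no: "\<not> ?thesis"
  define N where "N = {f :: 'a set \<Rightarrow> bit. sum f D = 0}"
  have "sum (f + g) D = sum f D + sum g D" "sum (edge_scale r f) D = r * sum f D"
    for r and f g :: "'a set \<Rightarrow> bit"
    by (simp_all only: plus_fun_def sum.distrib edge_scale_def sum_distrib_left)
  then have sub: "edge_space.subspace N"
    by (simp add: edge_space.subspace_def N_def)
  \<comment> \<open>Both sides are the parity of \<open>D \<inter> cycle_edges b\<close>.\<close>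
  have swap: "sum (cycle_vector b) D = (\<Sum>e\<in>cycle_edges b. of_bool (e \<in> D))" for b
  proof -
    have "finite (cycle_edges b)" by (simp add: cycle_edges_def)
    moreover have "D \<inter> {e. e \<in> cycle_edges b} = cycle_edges b \<inter> {e. e \<in> D}" by auto
    ultimately show ?thesis unfolding cycle_vector_def by (simp only: sum_of_bool_eq fin)
  qed
  have "{cycle_vector b | b. is_cycle G b \<and> length b \<le> l} \<subseteq> N"
    using no by (auto simp: N_def swap)
  then have "edge_space.span {cycle_vector b | b. is_cycle G b \<and> length b \<le> l} \<subseteq> N"
    by (rule edge_space.span_minimal[OF _ sub])
  then have "cycle_space G \<subseteq> N" using gen by (simp only: cycles_generate_def)
  moreover have "cycle_vector c \<in> cycle_space G"
    unfolding cycle_space_def using c by (intro edge_space.span_base) auto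
  ultimately show False using odd by (auto simp: N_def swap)
qed

text \<open>A path through \<open>K\<close> and a path outside it close up to a cycle that meets the
  cut between \<open>F\<close> and \<open>K\<close> only in the edge at \<open>f1\<close>. So some
  cycle of length at most \<open>l\<close> is odd on the cut, and \<open>cycle_segment\<close> reads
  the link off it.\<close>

lemma short_link:
  assumes G: "finite_simple_graph G" and gen: "cycles_generate G l"
    and KV: "K \<subseteq> verts G" and FV: "F \<subseteq> verts G" and conn: "connset (edges G) K" and FK: "F \<inter> K = {}"
    and f1: "f1 \<in> F \<inter> nbs (edges G) K" and f2: "f2 \<in> nbs (edges G) K - F"
    and outside: "(f1, f2) \<in> reach (edges G) (verts G - K)"
    and nonadj: "\<And>a b. \<lbrakk>a \<in> F; b \<in> nbs (edges G) K - F\<rbrakk> \<Longrightarrow> {a, b} \<notin> edges G"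
  shows "\<exists>a\<in>F. \<exists>b\<in>nbs (edges G) K - F. \<exists>q. distinct q \<and> set q \<subseteq> K \<and> length q + 3 \<le> l \<and>
           successively (\<lambda>x y. {x, y} \<in> edges G) (a # q @ [b])"
proof -
  let ?adj = "\<lambda>x y. {x, y} \<in> edges G"
  obtain k1 k2 where k: "k1 \<in> K" "k2 \<in> K" "{k1, f1} \<in> edges G" "{k2, f2} \<in> edges G"
    using f1 f2 by (auto simp: nbs_def)
  have "(k1, k2) \<in> reach (edges G) K" using conn k by (simp add: connset_def)
  then obtain p1 where p1: "p1 \<noteq> []" "hd p1 = k1" "last p1 = k2" "distinct p1" "set p1 \<subseteq> K"
    "successively ?adj p1"
    using reach_path k(1) by metis
  have "f2 \<in> verts G - K"
    using f2 k G by (auto simp: nbs_def finite_simple_graph_def)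
  then obtain p2 where p2: "p2 \<noteq> []" "hd p2 = f2" "last p2 = f1" "distinct p2"
    "set p2 \<subseteq> verts G - K" "successively ?adj p2"
    using reach_path reach_sym[OF outside] by metis
  \<comment> \<open>\<open>f1\<close> and \<open>f2\<close> differ, since only \<open>f1\<close> is
    in \<open>F\<close>. So the cycle has at least three vertices even if
    \<open>k1 = k2\<close>.\<close>
  have "length p2 \<noteq> 1" using p2 f1 f2 by (auto simp: length_Suc_conv)
  then have "length p2 \<ge> 2" using p2(1) by (cases p2 rule: walk_edges.cases) auto
  moreover have "length p1 \<ge> 1" using p1(1) by (cases p1) auto
  ultimately have len: "length (p1 @ p2) \<ge> 3" by simp
  have "is_cycle G (p1 @ p2)"
    unfolding is_cycle_def cycle_edges_def walk_edges_iff insert_subset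
    using len p1 p2 k KV by (auto simp: successively_append_iff insert_commute)
  moreover have "sum (cross F K) (cycle_edges (p1 @ p2)) \<noteq> 0"
  proof -
    have d: "distinct (p1 @ p2)" using p1 p2 by auto
    have e1: "p1 = butlast p1 @ [k2]" using p1 by (metis append_butlast_last_id)
    have e2: "p2 = f2 # tl p2" using p2 by (metis list.collapse)
    have e3: "p2 = butlast p2 @ [f1]" using p2 by (metis append_butlast_last_id)
    have "walk_sum (cross F K) ((p1 @ p2) @ [hd (p1 @ p2)])
        = walk_sum (cross F K) (butlast p1 @ k2 # (p2 @ [k1]))"
      using p1 by (subst e1) simp
    also have "\<dots> = walk_sum (cross F K) p1 + walk_sum (cross F K) (k2 # p2 @ [k1])"
      by (subst walk_sum_append) (simp flip: e1)
    also have "walk_sum (cross F K) (k2 # p2 @ [k1]) = cross F K {f2, k2} + walk_sum (cross F K) (p2 @ [k1])"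
      by (subst (1 2) e2) (simp add: insert_commute)
    also have "walk_sum (cross F K) (p2 @ [k1]) = walk_sum (cross F K) (butlast p2 @ f1 # [k1])"
      by (subst e3) simp
    also have "\<dots> = walk_sum (cross F K) p2 + cross F K {f1, k1}"
      by (subst walk_sum_append) (simp flip: e3)
    also have "walk_sum (cross F K) p1 = 0" using walk_sum_inside[OF FK p1(5)] .
    also have "walk_sum (cross F K) p2 = 0" using p2(5) by (intro walk_sum_outside[OF FK]) auto
    also have "cross F K {f2, k2} = 0"
      using cross_boundary[OF FK, of f2 k2] f2 k by (auto simp: nbs_def)
    also have "cross F K {f1, k1} = 1"
      using cross_boundary[OF FK, of f1 k1] f1 k by (auto simp: nbs_def)
    finally show ?thesis using sum_cycle_edges[OF d len, of "cross F K"] by simp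
  qed
  moreover have "finite (cross_edges F K)"
  proof -
    have "finite F" "finite K" using FV KV G finite_subset by (auto simp: finite_simple_graph_def)
    moreover have "cross_edges F K = (\<lambda>(x, y). {x, y}) ` (F \<times> K)"
      by (auto simp: cross_edges_def)
    ultimately show ?thesis by simp
  qed
  ultimately obtain c where c: "is_cycle G c" "length c \<le> l" "sum (cross F K) (cycle_edges c) \<noteq> 0"
    using odd_short_cycle[OF gen, of "cross_edges F K" "p1 @ p2"] by blast
  from cycle_segment[OF FK c(1,3) nonadj] obtain a b q where "a \<in> F" "b \<in> nbs (edges G) K - F"
    "distinct q" "set q \<subseteq> K" "length q + 3 \<le> length c" "successively ?adj (a # q @ [b])"
    by blast
  with c(2) show ?thesis by (intro bexI[of _ a] bexI[of _ b] exI[of _ q]) auto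
qed

section \<open>Linked partitions\<close>

text \<open>
  The final value of \<open>\<Union>P\<close> is a part of the connected tree-decomposition; \<open>m\<close> will be \<open>\<ell> - 3\<close>. Every
  link lowers the number of blocks, which is what bounds the number of links.
\<close>

inductive linked :: "'a set set \<Rightarrow> nat \<Rightarrow> 'a set \<Rightarrow> 'a set set \<Rightarrow> bool" for E m X where
  singletons: "linked E m X ((\<lambda>x. {x}) ` X)"
| link: "\<lbrakk>linked E m X P; A \<in> P; B \<in> P; A \<noteq> B; a \<in> A; b \<in> B; distinct q; set q \<inter> \<Union>P = {};
          length q \<le> m; successively (\<lambda>x y. {x, y} \<in> E) (a # q @ [b])\<rbrakk>
         \<Longrightarrow> linked E m X (insert (A \<union> B \<union> set q) (P - {A, B}))"

lemma linked_covers: "linked E m X P \<Longrightarrow> X \<subseteq> \<Union>P"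
  by (induction rule: linked.induct) auto

lemma linked_unique: "\<lbrakk>linked E m X P; C \<in> P; D \<in> P; x \<in> C; x \<in> D\<rbrakk> \<Longrightarrow> C = D"
proof (induction arbitrary: C D rule: linked.induct)
  case (link P A B a b q)
  have *: "C \<in> {A, B}" if "C \<in> P" "x \<in> C" "x \<in> A \<union> B \<union> set q" for C
  proof -
    have "x \<in> A \<union> B" using that link.hyps(8) by auto
    then show ?thesis using link.IH[OF that(1) link.hyps(2)] link.IH[OF that(1) link.hyps(3)] that(2) by auto
  qed
  show ?case
    using link.prems link.IH[of C D] *[of C] *[of D] by auto
qed auto

lemma linked_block:
  assumes "linked E m X P" "C \<in> P"
  shows "connset E C \<and> C \<inter> X \<noteq> {}"
  using assms
proof (induction arbitrary: C rule: linked.induct)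
  case (link P A B a b q)
  have w: "connset E (set (a # q @ [b]))" by (rule walk_connset) (use link in auto)
  have "connset E (A \<union> set (a # q @ [b]) \<union> B)"
    using link w by (intro connset_Un) auto
  moreover have "A \<union> set (a # q @ [b]) \<union> B = A \<union> B \<union> set q" using link by auto
  ultimately show ?case using link by auto
qed (auto simp: connset_def)

text \<open>A link costs one block and adds at most \<open>m\<close> vertices, so
  \<open>card X - card P\<close> counts the links made so far.\<close>

lemma linked_card:
  assumes "linked E m X P" "finite X"
  shows "finite P \<and> finite (\<Union>P) \<and> card P \<le> card X \<and> card (\<Union>P) \<le> card X + m * (card X - card P)"
  using assms(1)
proof (induction rule: linked.induct)
  case singletons
  have "card ((\<lambda>x. {x}) ` X) = card X" by (intro card_image) (auto simp: inj_on_def)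
  then show ?case using assms(2) by auto
next
  case (link P A B a b q)
  let ?N = "A \<union> B \<union> set q"
  \<comment> \<open>The new block differs from the remaining ones, so the number of blocks drops by
    exactly one.\<close>
  have "?N \<notin> P - {A, B}"
  proof
    assume N: "?N \<in> P - {A, B}"
    then have "?N = A" using linked_unique[OF link.hyps(1) _ link.hyps(2)] link.hyps(5) by blast
    then show False using N by blast
  qed
  moreover have "card {A, B} = 2" using link by simp
  moreover have "card {A, B} \<le> card P" using link by (intro card_mono) auto
  moreover have "card (P - {A, B}) = card P - card {A, B}"
    using link by (intro card_Diff_subset) auto
  ultimately have c: "card (insert ?N (P - {A, B})) + 1 = card P" using link by simp
  have U: "\<Union>(insert ?N (P - {A, B})) = \<Union>P \<union> set q" using link by auto
  have "card (\<Union>P \<union> set q) \<le> card (\<Union>P) + m"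
    using card_Un_le[of "\<Union>P" "set q"] card_length[of q] link by linarith
  also have "\<dots> \<le> card X + m * (card X - card P + 1)" using link by simp
  also have "card X - card P + 1 = card X - card (insert ?N (P - {A, B}))"
    using c link by linarith
  finally show ?case using c U link by auto
qed

text \<open>
  The path is cut into links at the singleton blocks it meets.
\<close>

lemma linked_path:
  assumes "linked E m X P" "A \<in> P" "B \<in> P" "A \<noteq> B" "a \<in> A" "b \<in> B" "distinct q"
    "set q \<inter> A = {}" "set q \<inter> B = {}" "\<And>z. z \<in> set q \<inter> \<Union>P \<Longrightarrow> {z} \<in> P" "length q \<le> m"
    "successively (\<lambda>x y. {x, y} \<in> E) (a # q @ [b])"
  shows "linked E m X (insert (A \<union> B \<union> set q) (P - {A, B} - (\<lambda>z. {z}) ` set q))"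
  using assms
proof (induction "length q" arbitrary: q P A a rule: less_induct)
  case less
  show ?case
  proof (cases "set q \<inter> \<Union>P = {}")
    case True
    then have "P - {A, B} - (\<lambda>z. {z}) ` set q = P - {A, B}" by auto
    then show ?thesis using linked.link[of E m X P A B a b q] less.prems True by simp
  next
    case False
    \<comment> \<open>\<open>z\<close> is the first vertex of \<open>q\<close> already in use. The
      piece before it links \<open>A\<close> to \<open>{z}\<close>, and the induction continues from
      \<open>z\<close> in the enlarged block.\<close>
    then obtain q1 z q2 where q: "q = q1 @ z # q2" "z \<in> \<Union>P" "\<forall>y\<in>set q1. y \<notin> \<Union>P"
      using split_list_first_prop[of q "\<lambda>z. z \<in> \<Union>P"] by blast
    have z: "{z} \<in> P" using less.prems(10)[of z] q by auto
    have zA: "{z} \<noteq> A" "{z} \<noteq> B" "z \<notin> A" "z \<notin> B" using less.prems(8,9) q by auto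
    have walk: "successively (\<lambda>x y. {x, y} \<in> E) ((a # q1) @ z # (q2 @ [b]))"
      using less.prems(12) q by simp
    let ?A = "A \<union> {z} \<union> set q1" let ?P = "insert ?A (P - {A, {z}})"
    have l: "linked E m X ?P"
    proof (rule linked.link[OF less.prems(1,2) z _ less.prems(5)])
      show "successively (\<lambda>x y. {x, y} \<in> E) (a # q1 @ [z])"
        using walk successively_split[of _ "a # q1" z "q2 @ [b]"] by simp
      show "distinct q1" "length q1 \<le> m" using less.prems(7,11) q by auto
      show "set q1 \<inter> \<Union>P = {}" using q by auto
    qed (use zA in auto)
    have "A \<inter> B = {}" using linked_unique[OF less.prems(1-3)] less.prems(4) by auto
    moreover have "B \<inter> set q1 = {}" using less.prems(3) q(3) by auto
    ultimately have BA: "B \<inter> ?A = {}" using zA by auto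
    have "linked E m X (insert (?A \<union> B \<union> set q2) (?P - {?A, B} - (\<lambda>z. {z}) ` set q2))"
    proof (rule less.hyps)
      show "length q2 < length q" "length q2 \<le> m" using q less.prems by auto
      show "successively (\<lambda>x y. {x, y} \<in> E) (z # q2 @ [b])"
        using walk successively_split[of _ "a # q1" z "q2 @ [b]"] by simp
      show "?A \<noteq> B" using BA \<open>b \<in> B\<close> by auto
      show "set q2 \<inter> ?A = {}" using less.prems q by auto
      fix x assume x: "x \<in> set q2 \<inter> \<Union>?P"
      then have "x \<notin> ?A" using less.prems q by auto
      then have "x \<in> \<Union>P" using x by auto
      then have "{x} \<in> P" using less.prems(10)[of x] x q by auto
      moreover have "{x} \<noteq> A" "{x} \<noteq> {z}" using less.prems x q by auto
      ultimately show "{x} \<in> ?P" by auto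
    qed (use less.prems q l zA in auto)
    moreover have "insert (?A \<union> B \<union> set q2) (?P - {?A, B} - (\<lambda>z. {z}) ` set q2)
        = insert (A \<union> B \<union> set q) (P - {A, B} - (\<lambda>z. {z}) ` set q)"
    proof -
      have "?A \<union> B \<union> set q2 = A \<union> B \<union> set q" using q by auto
      moreover have "?P - {?A, B} - (\<lambda>z. {z}) ` set q2 = P - {A, B} - (\<lambda>z. {z}) ` set q"
      proof -
        have "?A \<notin> P" "\<And>y. y \<in> set q1 \<Longrightarrow> {y} \<notin> P"
        proof -
          show "?A \<notin> P"
          proof
            assume "?A \<in> P"
            moreover have "?A \<noteq> A" using zA by auto
            ultimately show False
              using linked_unique[OF less.prems(1) _ less.prems(2), of ?A a] less.prems(5) by auto
          qed
          show "\<And>y. y \<in> set q1 \<Longrightarrow> {y} \<notin> P" using q by auto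
        qed
        then show ?thesis using q by auto
      qed
      ultimately show ?thesis by simp
    qed
    ultimately show ?thesis by simp
  qed
qed

section \<open>Handing links down to a child\<close>

text \<open>The interior of a link avoids \<open>X\<close>, which contains the boundary of
  \<open>K\<close>, so it lies in \<open>K\<close> or misses it. Links of the second kind are
  dropped, the others are replayed and cut at the vertices of \<open>X'\<close>. The last clause
  keeps the ends of a replayed link in different blocks.\<close>

lemma linked_inherit:
  assumes "linked E m X P" and KX: "K \<inter> X = {}" "nbs E K \<subseteq> X" and X': "nbs E K \<subseteq> X'" "X' \<subseteq> K \<union> nbs E K"
  shows "\<exists>P'. linked E m X' P' \<and> \<Union>P' = X' \<union> (\<Union>P \<inter> K) \<and>
           (\<forall>C\<in>P'. (\<exists>B\<in>P. C \<subseteq> B) \<or> (\<exists>x\<in>X' - \<Union>P. C = {x}))"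
  using assms(1)
proof (induction rule: linked.induct)
  case singletons
  show ?case
    by (rule exI[of _ "(\<lambda>x. {x}) ` X'"]) (use KX in \<open>auto intro: linked.singletons\<close>)
next
  case (link P A B a b q)
  let ?N = "A \<union> B \<union> set q" let ?P = "insert ?N (P - {A, B})"
  have U: "\<Union>?P = \<Union>P \<union> set q" using link.hyps by auto
  obtain P' where "linked E m X' P' \<and> \<Union>P' = X' \<union> (\<Union>P \<inter> K) \<and>
      (\<forall>C\<in>P'. (\<exists>B\<in>P. C \<subseteq> B) \<or> (\<exists>x\<in>X' - \<Union>P. C = {x}))"
    using link.IH by (rule exE)
  then have P': "linked E m X' P'" "\<Union>P' = X' \<union> (\<Union>P \<inter> K)"
    "\<And>C. C \<in> P' \<Longrightarrow> (\<exists>B\<in>P. C \<subseteq> B) \<or> (\<exists>x\<in>X' - \<Union>P. C = {x})"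
    by simp_all
  have coarser: "\<exists>B\<in>?P. C \<subseteq> B" if C: "\<exists>B\<in>P. C \<subseteq> B" for C
  proof -
    obtain D where "D \<in> P" "C \<subseteq> D" using C by auto
    then show ?thesis by (cases "D = A \<or> D = B") auto
  qed
  show ?case
  proof (cases "set q \<inter> K = {}")
    case True
    have "(\<exists>B\<in>?P. C \<subseteq> B) \<or> (\<exists>x\<in>X' - \<Union>?P. C = {x})" if C: "C \<in> P'" for C
    proof (cases "\<exists>B\<in>P. C \<subseteq> B")
      case False
      then obtain x where "x \<in> X' - \<Union>P" "C = {x}" using P'(3)[OF C] by blast
      then show ?thesis unfolding U by auto
    qed (use coarser in simp)
    then show ?thesis using P' True unfolding U by (intro exI[of _ P']) auto
  next
    case False
    have qP: "set q \<inter> X = {}" using link.hyps(8) linked_covers[OF link.hyps(1)] by auto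
    have qne: "q \<noteq> []" using False by auto
    have "connset E (set q)"
      using link.hyps(10) qne by (intro walk_connset) (auto simp: successively_append_iff successively_Cons)
    then have qK: "set q \<subseteq> K"
      using connset_subset[of E "set q" K] False qP KX by blast
    have "{a, hd q} \<in> E" "{last q, b} \<in> E"
      using link.hyps(10) qne by (auto simp: successively_append_iff successively_Cons)
    moreover have "hd q \<in> K" "last q \<in> K" using qK qne by auto
    ultimately have ab: "a \<in> K \<union> nbs E K" "b \<in> K \<union> nbs E K"
      by (auto simp: nbs_def insert_commute)
    have "a \<in> \<Union>P" "b \<in> \<Union>P" using link.hyps by auto
    then have "a \<in> \<Union>P'" "b \<in> \<Union>P'" using ab X' P'(2) by auto
    then obtain A' B' where A': "A' \<in> P'" "a \<in> A'" and B': "B' \<in> P'" "b \<in> B'" by auto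
    have "A' \<subseteq> A" if h: "A' \<in> P'" "a \<in> A'" "A \<in> P" "a \<in> A" for A' A a
    proof -
      obtain D where "D \<in> P" "A' \<subseteq> D" using P'(3)[of A'] h by auto
      moreover have "D = A" using linked_unique[OF link.hyps(1) \<open>D \<in> P\<close> h(3)] \<open>A' \<subseteq> D\<close> h by auto
      ultimately show ?thesis by simp
    qed
    then have sub: "A' \<subseteq> A" "B' \<subseteq> B" using A' B' link.hyps(2,3,5,6) by metis+
    have AB: "A \<inter> B = {}" using linked_unique[OF link.hyps(1-3)] link.hyps(4) by auto
    let ?N' = "A' \<union> B' \<union> set q" let ?P' = "insert ?N' (P' - {A', B'} - (\<lambda>z. {z}) ` set q)"
    \<comment> \<open>A vertex of \<open>q\<close> is not covered by \<open>P\<close>, so if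
      \<open>P'\<close> covers it, its block is a new singleton.\<close>
    have sing: "{z} \<in> P'" if z: "z \<in> set q \<inter> \<Union>P'" for z
    proof -
      obtain C where C: "C \<in> P'" "z \<in> C" using z by auto
      then show ?thesis using P'(3)[of C] z link.hyps(8) by auto
    qed
    have l: "linked E m X' ?P'"
    proof (rule linked_path[where a = a and b = b])
      show "A' \<noteq> B'" using sub AB A' by auto
      show "set q \<inter> A' = {}" "set q \<inter> B' = {}" using sub link.hyps(2,3,8) by blast+
    qed (use P' A' B' link.hyps sing in auto)
    have U': "\<Union>?P' = X' \<union> (\<Union>?P \<inter> K)"
    proof -
      have "\<Union>?P' = \<Union>P' \<union> set q" using A' B' by auto
      then show ?thesis unfolding U P'(2) using qK by auto
    qed
    have r: "(\<exists>B\<in>?P. C \<subseteq> B) \<or> (\<exists>x\<in>X' - \<Union>?P. C = {x})" if C: "C \<in> ?P'" for C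
    proof (cases "C = ?N'")
      case True
      then have "C \<subseteq> ?N" using sub by auto
      then show ?thesis by simp
    next
      case False
      show ?thesis
      proof (cases "\<exists>B\<in>P. C \<subseteq> B")
        case False
        have "C \<in> P'" using C \<open>C \<noteq> ?N'\<close> by simp
        then obtain x where "x \<in> X' - \<Union>P" "C = {x}" using P'(3) False by blast
        moreover have "x \<notin> set q" using C \<open>C \<noteq> ?N'\<close> \<open>C = {x}\<close> by auto
        ultimately show ?thesis unfolding U by auto
      qed (use coarser in simp)
    qed
    show ?thesis by (intro exI[of _ ?P'] conjI ballI l U' r)
  qed
qed

section \<open>Joining all blocks by short links\<close>

lemma linked_connect:
  assumes G: "finite_simple_graph G" and gen: "cycles_generate G l" and E: "E = edges G" and V: "V = verts G"
    and CV: "C \<union> nbs E C \<subseteq> V" and conn: "connset E (C \<union> nbs E C)"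
    and X: "nbs E C \<subseteq> X" "X \<noteq> {}" "finite X"
    and irr: "\<And>K x y. \<lbrakk>K \<in> comps E (C - X); x \<in> X; y \<in> X\<rbrakk> \<Longrightarrow> (x, y) \<in> reach E (V - K)"
    and "linked E (l - 3) X P" "\<Union>P \<subseteq> C \<union> nbs E C"
  shows "\<exists>P'. linked E (l - 3) X P' \<and> \<Union>P \<subseteq> \<Union>P' \<and> \<Union>P' \<subseteq> C \<union> nbs E C \<and> connset E (\<Union>P')"
  using assms(11,12)
proof (induction "card P" arbitrary: P rule: less_induct)
  case less
  let ?W = "C \<union> nbs E C"
  define F where "F = \<Union>P"
  have XF: "X \<subseteq> F" using linked_covers less.prems(1) F_def by metis
  have FW: "F \<subseteq> ?W" using less.prems(2) F_def by simp
  show ?case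
  proof (cases "connset E F")
    case True
    then show ?thesis using less.prems F_def by (intro exI[of _ P]) auto
  next
    case False
    obtain x where "x \<in> X" using X(2) by auto
    then have "x \<in> F" using XF by (rule subsetD[rotated])
    then obtain F1 where F1: "F1 \<in> comps E F" using comps_exists by metis
    note f1 = compsD[OF F1]
    have "F1 \<noteq> F" using False f1 by auto
    have "\<exists>K\<in>comps E (?W - F). F1 \<inter> nbs E K \<noteq> {} \<and> nbs E K - F1 \<noteq> {}"
    proof (rule ccontr)
      assume no: "\<not> ?thesis"
      \<comment> \<open>Without such a \<open>K\<close>, the set \<open>Z\<close> would be closed in
        the connected set \<open>?W\<close>, so it would contain \<open>F\<close>; but it meets
        \<open>F\<close> only in \<open>F1\<close>.\<close>
      define Z where "Z = F1 \<union> \<Union>{K \<in> comps E (?W - F). F1 \<inter> nbs E K \<noteq> {}}"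
      have "y \<in> Z" if z: "z \<in> Z" "{z, y} \<in> E" "y \<in> ?W" for z y
      proof (cases "z \<in> F1")
        case zF: True
        show ?thesis
        proof (cases "y \<in> F")
          case True
          then have "y \<in> F1" using f1(3) z zF by (auto simp: nbs_def)
          then show ?thesis by (auto simp: Z_def)
        next
          case False
          then have "y \<in> ?W - F" using z(3) by simp
          then obtain K where K: "K \<in> comps E (?W - F)" "y \<in> K" by (rule comps_exists)
          have "z \<notin> K" using compsD(2)[OF K(1)] subsetD[OF f1(2) zF] by blast
          then have "z \<in> nbs E K" using z(2) K(2) by (auto simp: nbs_def insert_commute)
          then show ?thesis using K zF by (auto simp: Z_def)
        qed
      next
        case False
        then obtain K where K: "K \<in> comps E (?W - F)" "z \<in> K" "F1 \<inter> nbs E K \<noteq> {}"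
          using z by (auto simp: Z_def)
        show ?thesis
        proof (cases "y \<in> K")
          case True
          then show ?thesis using K by (auto simp: Z_def)
        next
          case False
          then have "y \<in> nbs E K" using K z by (auto simp: nbs_def)
          then have "y \<in> F1" using no K by auto
          then show ?thesis by (auto simp: Z_def)
        qed
      qed
      then have "nbs E Z \<inter> ?W = {}" by (auto simp: nbs_def)
      moreover have "F1 \<subseteq> ?W \<inter> Z" using f1(2) FW by (auto simp: Z_def)
      then have "?W \<inter> Z \<noteq> {}" using f1(4) by auto
      ultimately have "?W \<subseteq> Z" using connset_subset[OF conn] by blast
      moreover have "Z \<inter> F \<subseteq> F1"
      proof -
        have "K \<inter> F = {}" if "K \<in> comps E (?W - F)" for K using compsD(2)[OF that] by auto
        then show ?thesis unfolding Z_def by blast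
      qed
      ultimately show False using \<open>F1 \<noteq> F\<close> f1(2) FW by blast
    qed
    then obtain K where K: "K \<in> comps E (?W - F)" "F1 \<inter> nbs E K \<noteq> {}" "nbs E K - F1 \<noteq> {}"
      by auto
    note k = compsD[OF K(1)]
    \<comment> \<open>\<open>F\<close> contains \<open>X\<close> and thus the boundary of
      \<open>C\<close>. So \<open>K\<close> lies in one child of \<open>X\<close>, whose
      irreducibility property then applies to \<open>K\<close>.\<close>
    have KCX: "K \<subseteq> C - X" using k(2) XF X(1) by blast
    have KF: "K \<inter> F = {}" using k(2) by auto
    have nKF: "nbs E K \<subseteq> F"
    proof -
      have "nbs E K \<subseteq> ?W" using nbs_subset[of K C E] KCX by auto
      then show ?thesis using k(3) by auto
    qed
    obtain u v where u: "u \<in> F1" "u \<in> nbs E K" and v: "v \<in> nbs E K" "v \<notin> F1" using K by auto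
    have FVK: "F \<subseteq> V - K" using FW CV KF by auto
    \<comment> \<open>Blocks are connected, meet \<open>X\<close> and avoid \<open>K\<close>, so the
      joins between vertices of \<open>X\<close> extend to all of \<open>F\<close>.\<close>
    have to_X: "\<exists>x\<in>X. (w, x) \<in> reach E (V - K)" if w: "w \<in> F" for w
    proof -
      obtain A where A: "A \<in> P" "w \<in> A" using w F_def by auto
      then obtain x where "x \<in> A" "x \<in> X" using linked_block[OF less.prems(1) A(1)] by auto
      moreover have "A \<subseteq> V - K" using A FVK F_def by auto
      ultimately show ?thesis
        using connset_reach[of E A w x "V - K"] linked_block[OF less.prems(1) A(1)] A by auto
    qed
    obtain Kc where Kc: "Kc \<in> comps E (C - X)" "K \<subseteq> Kc" using comps_absorb_exists[OF k(1) KCX] .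
    obtain x y where xy: "x \<in> X" "(u, x) \<in> reach E (V - K)" "y \<in> X" "(v, y) \<in> reach E (V - K)"
      using to_X[of u] to_X[of v] u v nKF by blast
    have "(x, y) \<in> reach E (V - K)"
      using irr[OF Kc(1) xy(1,3)] by (rule reach_mono) (use Kc in auto)
    then have uv: "(u, v) \<in> reach E (V - K)"
      by (rule reach_trans[OF reach_trans[OF xy(2)] reach_sym[OF xy(4)]])
    have "{a, b} \<notin> E" if "a \<in> F1" "b \<in> nbs E K - F1" for a b
      using that f1(3) nKF by (auto simp: nbs_def)
    moreover have "K \<subseteq> V" "F1 \<subseteq> V" "F1 \<inter> K = {}" using f1(2) FVK KCX CV by auto
    ultimately have "\<exists>a\<in>F1. \<exists>b\<in>nbs E K - F1. \<exists>q. distinct q \<and> set q \<subseteq> K \<and> length q + 3 \<le> l \<and>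
           successively (\<lambda>x y. {x, y} \<in> E) (a # q @ [b])"
      using short_link[OF G gen, of K F1 u v] k(1) uv u v unfolding E V by blast
    then obtain a b q where abq: "a \<in> F1" "b \<in> nbs E K" "b \<notin> F1" "distinct q" "set q \<subseteq> K"
      "length q + 3 \<le> l" "successively (\<lambda>x y. {x, y} \<in> E) (a # q @ [b])"
      by auto
    have "a \<in> F" "b \<in> F" using abq f1 nKF by auto
    then obtain A B where AB: "A \<in> P" "a \<in> A" "B \<in> P" "b \<in> B" using F_def by auto
    have "A \<subseteq> F1"
      by (rule comps_absorb[OF F1]) (use linked_block[OF less.prems(1) AB(1)] AB abq in \<open>auto simp: F_def\<close>)
    then have "A \<noteq> B" using AB abq by auto
    let ?P = "insert (A \<union> B \<union> set q) (P - {A, B})"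
    have l: "linked E (l - 3) X ?P"
      using abq AB \<open>A \<noteq> B\<close> KF unfolding F_def
      by (intro linked.link[OF less.prems(1), where a = a and b = b]) auto
    have U: "\<Union>?P = F \<union> set q" using AB F_def by auto
    have fin: "finite P" using linked_card[OF less.prems(1) X(3)] by auto
    have "card ?P < card P"
    proof -
      have "card (P - {A, B}) + 2 = card P"
        using card_Diff_subset[of "{A, B}" P] card_mono[OF fin, of "{A, B}"] AB \<open>A \<noteq> B\<close> by auto
      then show ?thesis using card_insert_le_m1[of "card P - 1" "P - {A, B}"] by (simp add: card_insert_if fin)
    qed
    moreover have "\<Union>?P \<subseteq> ?W" unfolding U using FW abq KCX by auto
    ultimately obtain P' where "linked E (l - 3) X P' \<and> \<Union>?P \<subseteq> \<Union>P' \<and> \<Union>P' \<subseteq> ?W \<and> connset E (\<Union>P')"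
      using less.hyps[OF _ l] by blast
    then show ?thesis unfolding U using F_def by (intro exI[of _ P']) auto
  qed
qed

section \<open>From tree-decompositions to territories\<close>

lemma tree_decompositionD:
  assumes "tree_decomposition G T P"
  shows "is_tree T" "verts G = (\<Union>t\<in>verts T. P t)"
    "e \<in> edges G \<Longrightarrow> \<exists>t\<in>verts T. e \<subseteq> P t"
    "\<lbrakk>is_path_between T t1 p t3; t2 \<in> set p\<rbrakk> \<Longrightarrow> P t1 \<inter> P t3 \<subseteq> P t2"
proof -
  note a = assms[unfolded tree_decomposition_def]
  show "is_tree T" "verts G = (\<Union>t\<in>verts T. P t)" using a by simp_all
  show "e \<in> edges G \<Longrightarrow> \<exists>t\<in>verts T. e \<subseteq> P t" using a by simp
  show "\<lbrakk>is_path_between T t1 p t3; t2 \<in> set p\<rbrakk> \<Longrightarrow> P t1 \<inter> P t3 \<subseteq> P t2" using a by metis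
qed

lemma tree_path: "\<lbrakk>is_tree T; a \<in> verts T; b \<in> verts T\<rbrakk> \<Longrightarrow> \<exists>p. is_path_between T a p b"
  by (simp add: is_tree_def connected_graph_def)

lemma tree_decomposition_vertex_connected:
  assumes td: "tree_decomposition G T P" and ab: "a \<in> verts T" "b \<in> verts T" "v \<in> P a" "v \<in> P b"
  shows "(a, b) \<in> reach (edges T) {u \<in> verts T. v \<in> P u}"
proof -
  obtain p where p: "is_path_between T a p b"
    using tree_path[OF tree_decompositionD(1)[OF td] ab(1,2)] by auto
  then have "P a \<inter> P b \<subseteq> P t" if "t \<in> set p" for t
    using tree_decompositionD(4)[OF td] that by metis
  then have "set p \<subseteq> {u \<in> verts T. v \<in> P u}"
    using p ab by (auto simp: is_path_between_def is_path_def)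
  then show ?thesis
    using walk_reach[of "edges T" p] p by (auto simp: is_path_between_def is_path_def walk_edges_iff)
qed

text \<open>The subtrees belonging to two adjacent vertices share a node, so those of the vertices
  of a connected set have a connected union.\<close>

lemma tree_decomposition_connset_connected:
  assumes td: "tree_decomposition G T P" and C: "connset (edges G) C"
    and a: "a \<in> verts T" "c \<in> P a" "c \<in> C" and b: "b \<in> verts T" "d \<in> P b" "d \<in> C"
  shows "(a, b) \<in> reach (edges T) {u \<in> verts T. P u \<inter> C \<noteq> {}}"
proof -
  have "(c, d) \<in> reach (edges G) C" using C a b by (auto simp: connset_def)
  then show ?thesis using b(1,2) unfolding reach_def[of "edges G"]
  proof (induction arbitrary: b rule: rtrancl_induct)
    case base
    show ?case
      by (rule reach_mono[OF tree_decomposition_vertex_connected[OF td, of _ _ c]])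
         (use a base in auto)
  next
    case (step y z)
    have "{y, z} \<in> edges G" using step(2) by simp
    then obtain q where q: "q \<in> verts T" "{y, z} \<subseteq> P q"
      using tree_decompositionD(3)[OF td] by metis
    have "(a, q) \<in> reach (edges T) {u \<in> verts T. P u \<inter> C \<noteq> {}}" using step.IH q by auto
    moreover have "(q, b) \<in> reach (edges T) {u \<in> verts T. P u \<inter> C \<noteq> {}}"
      by (rule reach_mono[OF tree_decomposition_vertex_connected[OF td, of _ _ z]])
         (use step q in auto)
    ultimately show ?case by (rule reach_trans)
  qed
qed

text \<open>\<open>u\<close> is the first node towards \<open>u0\<close> whose part meets
  \<open>C\<close>. A boundary vertex \<open>s\<close> shares a part with a vertex of
  \<open>C\<close>. The way to \<open>u\<close> and its continuation among nodes meeting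
  \<open>C\<close> form a path to that part, and \<open>s\<close> lies in the parts at both ends,
  hence in \<open>P u\<close>.\<close>

lemma tree_decomposition_entry_bag:
  assumes td: "tree_decomposition G T P" and C: "connset (edges G) C"
    and t0: "t0 \<in> verts T" "nbs (edges G) C \<subseteq> P t0" "C \<inter> P t0 = {}" and u0: "u0 \<in> verts T" "P u0 \<inter> C \<noteq> {}"
  shows "\<exists>u\<in>verts T. nbs (edges G) C \<subseteq> P u \<and> P u \<inter> C \<noteq> {}"
proof -
  let ?TC = "{u \<in> verts T. P u \<inter> C \<noteq> {}}"
  obtain p where p: "is_path_between T t0 p u0"
    using tree_path[OF tree_decompositionD(1)[OF td] t0(1) u0(1)] by auto
  then have "u0 \<in> set p" by (auto simp: is_path_between_def is_path_def)
  then have "\<exists>y\<in>set p. y \<in> ?TC" using u0 by auto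
  then obtain p1 u p2 where p12: "p = p1 @ u # p2" "u \<in> ?TC" "\<forall>y\<in>set p1. y \<notin> ?TC"
    by (rule split_list_first_propE)
  have "s \<in> P u" if s: "s \<in> nbs (edges G) C" for s
  proof -
    obtain c where c: "c \<in> C" "{c, s} \<in> edges G" using s by (auto simp: nbs_def)
    obtain q where q: "q \<in> verts T" "{c, s} \<subseteq> P q"
      using tree_decompositionD(3)[OF td c(2)] by metis
    obtain c' where "c' \<in> P u" "c' \<in> C" using p12 by auto
    then have "(u, q) \<in> reach (edges T) ?TC"
      using tree_decomposition_connset_connected[OF td C, of u c' q c] p12 q c by auto
    from reach_path[OF this p12(2)]
    obtain r where r: "r \<noteq> []" "hd r = u" "last r = q" "distinct r" "set r \<subseteq> ?TC"
      "successively (\<lambda>x y. {x, y} \<in> edges T) r"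
      by auto
    have "p1 \<noteq> []" using p12 p t0 by (auto simp: is_path_between_def)
    then have "is_path_between T t0 (p1 @ r) q"
      using p p12 r unfolding is_path_between_def is_path_def walk_edges_iff
      by (auto simp: successively_append_iff successively_Cons)
    moreover have "u \<in> set (p1 @ r)" using r by auto
    ultimately have "P t0 \<inter> P q \<subseteq> P u" by (rule tree_decompositionD(4)[OF td])
    then show ?thesis using s t0 q by auto
  qed
  then show ?thesis using p12 by auto
qed

text \<open>The bags are parts cut down to \<open>C\<close> and its boundary. The node chosen for
  \<open>C\<close> then has a part that contains the boundary of each child and avoids the child, as
  the induction requires.\<close>

lemma tree_decomposition_win:
  assumes td: "tree_decomposition G T P" and k: "\<And>t. t \<in> verts T \<Longrightarrow> card (P t) \<le> k"
    and G: "finite_simple_graph G"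
  shows "\<lbrakk>connset (edges G) C; C \<subseteq> verts G;
    nbs (edges G) C = {} \<or> (\<exists>t\<in>verts T. nbs (edges G) C \<subseteq> P t \<and> C \<inter> P t = {})\<rbrakk> \<Longrightarrow> win (edges G) k UNIV C"
proof (induction "card C" arbitrary: C rule: less_induct)
  case less
  have fin: "finite (verts G)" using G by (simp add: finite_simple_graph_def)
  obtain c where "c \<in> C" using connset_nonempty less.prems(1) by blast
  then have "c \<in> (\<Union>t\<in>verts T. P t)" using less.prems(2) tree_decompositionD(2)[OF td] by auto
  then obtain u0 where "u0 \<in> verts T" "P u0 \<inter> C \<noteq> {}"
    using \<open>c \<in> C\<close> by auto
  then obtain u where u: "u \<in> verts T" "nbs (edges G) C \<subseteq> P u" "P u \<inter> C \<noteq> {}"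
  proof (cases "nbs (edges G) C = {}")
    case False
    then obtain t where "t \<in> verts T" "nbs (edges G) C \<subseteq> P t" "C \<inter> P t = {}" using less.prems(3) by auto
    then have "\<exists>u\<in>verts T. nbs (edges G) C \<subseteq> P u \<and> P u \<inter> C \<noteq> {}"
      by (rule tree_decomposition_entry_bag[OF td less.prems(1) _ _ _ \<open>u0 \<in> verts T\<close> \<open>P u0 \<inter> C \<noteq> {}\<close>])
    then show ?thesis using that by blast
  qed (use that \<open>u0 \<in> verts T\<close> \<open>P u0 \<inter> C \<noteq> {}\<close> in auto)
  have Pu: "finite (P u)"
    using u(1) fin finite_subset[of "P u" "verts G"] tree_decompositionD(2)[OF td] by auto
  let ?X = "P u \<inter> (C \<union> nbs (edges G) C)"
  show ?case
  proof (rule winI[of _ _ ?X])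
    show "card ?X \<le> k" using k[OF u(1)] card_mono[OF Pu, of ?X] by auto
    fix K assume K: "K \<in> comps (edges G) (C - ?X)"
    note k = compsD[OF K]
    have "K \<subset> C" using k u by auto
    then have "card K < card C"
      using less.prems(2) fin finite_subset psubset_card_mono by metis
    moreover have "nbs (edges G) K \<subseteq> P u" using comps_nbs[OF K] u by auto
    moreover have "K \<inter> P u = {}" using k by auto
    ultimately show "win (edges G) k UNIV K"
      by (intro less.hyps disjI2 bexI[of _ u]) (use k \<open>K \<subset> C\<close> less.prems(2) u in auto)
  qed (use u in auto)
qed

text \<open>
  The empty tree is allowed so that the construction can start from nothing.
\<close>

definition partial_decomposition :: "'a graph \<Rightarrow> nat \<Rightarrow> nat graph \<Rightarrow> (nat \<Rightarrow> 'a set) \<Rightarrow> bool" where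
  "partial_decomposition G N T P \<longleftrightarrow> (is_tree T \<or> verts T = {}) \<and>
     (\<forall>t1 t2 t3 p. is_path_between T t1 p t3 \<and> t2 \<in> set p \<longrightarrow> P t1 \<inter> P t3 \<subseteq> P t2) \<and>
     (\<forall>t\<in>verts T. connected_in G (P t) \<and> card (P t) \<le> N)"

section \<open>Growing a tree by a leaf\<close>

lemma cycle_edges_vertices: "\<lbrakk>e \<in> cycle_edges c; c \<noteq> []\<rbrakk> \<Longrightarrow> e \<subseteq> set c"
  unfolding cycle_edges_def using walk_edges_vertices[of e c] by (elim insertE) simp_all

text \<open>A cycle through \<open>n\<close> would need two different neighbours of
  \<open>n\<close>, and \<open>s\<close> is the only one.\<close>

lemma is_tree_add_leaf:
  assumes T: "is_tree T" and s: "s \<in> verts T" and n: "n \<notin> verts T"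
  shows "is_tree \<lparr>verts = insert n (verts T), edges = insert {n, s} (edges T)\<rparr>" (is "is_tree ?T")
proof -
  have fs: "finite_simple_graph T" using T by (simp add: is_tree_def)
  then have nE: "e \<in> edges T \<Longrightarrow> n \<notin> e" for e using n by (auto simp: finite_simple_graph_def)
  have sn: "s \<noteq> n" using s n by auto
  have "finite_simple_graph ?T"
    using fs s sn by (auto simp: finite_simple_graph_def)
  moreover have "connected_graph ?T"
  proof -
    have "reach (edges T) W \<subseteq> reach (edges ?T) W" for W
      unfolding reach_def by (rule rtrancl_mono) auto
    then have "connset (edges ?T) (verts T)"
      using T by (auto simp: is_tree_def connected_graph_iff connset_def)
    then have "connset (edges ?T) (insert n (verts T))"
      by (rule connset_insert_nb[OF _ s]) (simp add: insert_commute)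
    then show ?thesis by (simp add: connected_graph_iff)
  qed
  moreover have "\<not> is_cycle ?T c" for c
  proof
    assume c: "is_cycle ?T c"
    show False
    proof (cases "n \<in> set c")
      case True
      obtain r where r: "distinct (n # r)" "Suc (length r) = length c"
        "successively (\<lambda>x y. {x, y} \<in> edges ?T) (n # r @ [n])"
        using cycle_rotate[OF c True, of "\<lambda>_. 0 :: nat"] by auto
      have "length r \<ge> 2" using r(2) c by (simp add: is_cycle_def)
      then obtain x y r' where r': "r = x # y # r'" by (cases r rule: walk_edges.cases) auto
      have "successively P (n # r @ [n]) \<Longrightarrow> P n x \<and> P (last r) n" for P
      proof
        assume walk: "successively P (n # r @ [n])"
        then show "P n x" by (simp add: r')
        have "r \<noteq> []" using r' by simp
        then obtain ys z where ys: "r = ys @ [z]" by (meson rev_exhaust)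
        then show "P (last r) n" using walk successively_split[of P "n # ys" z "[n]"] by simp
      qed
      from this[OF r(3)] have "{n, x} \<in> edges ?T" "{last r, n} \<in> edges ?T" by simp_all
      then have "x = s" "last r = s" using nE by (auto simp: doubleton_eq_iff)
      moreover have "last r \<in> set (y # r')" using r' by auto
      ultimately show False using r(1) r' by auto
    next
      case False
      have c': "length c \<ge> 3" "distinct c" "set c \<subseteq> insert n (verts T)"
        "cycle_edges c \<subseteq> insert {n, s} (edges T)"
        using c by (simp_all add: is_cycle_def)
      have "c \<noteq> []" using c'(1) by auto
      then have "{n, s} \<notin> cycle_edges c" using cycle_edges_vertices[of "{n, s}" c] False by auto
      then have "is_cycle T c" unfolding is_cycle_def using c' False by auto
      then show False using T by (auto simp: is_tree_def)
    qed
  qed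
  ultimately show ?thesis by (simp add: is_tree_def)
qed

lemma path_drop_leaf:
  assumes "is_path \<lparr>verts = insert n (verts T), edges = insert {n, s} (edges T)\<rparr> p" "n \<notin> set p"
  shows "is_path T p"
proof -
  have "e \<noteq> {n, s}" if "e \<in> walk_edges p" for e
    using walk_edges_vertices[OF that] assms(2) by auto
  then show ?thesis using assms by (auto simp: is_path_def)
qed

text \<open>\<open>n\<close> can only be an end of a path, which then continues from
  \<open>s\<close> inside \<open>T\<close>. What \<open>B\<close> shares with the old parts lies in
  \<open>P s\<close>, so the old property applies from \<open>s\<close> on.\<close>

lemma leaf_path_property:
  assumes T: "is_tree T" and s: "s \<in> verts T" and n: "n \<notin> verts T"
    and path: "\<forall>t1 t2 t3 p. is_path_between T t1 p t3 \<and> t2 \<in> set p \<longrightarrow> P t1 \<inter> P t3 \<subseteq> P t2"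
    and B: "B \<inter> \<Union>(P ` verts T) \<subseteq> P s"
    and p: "is_path_between \<lparr>verts = insert n (verts T), edges = insert {n, s} (edges T)\<rparr> t1 p t3"
    and t2: "t2 \<in> set p"
  shows "(P(n := B)) t1 \<inter> (P(n := B)) t3 \<subseteq> (P(n := B)) t2"
proof -
  let ?T = "\<lparr>verts = insert n (verts T), edges = insert {n, s} (edges T)\<rparr>"
  have nE: "e \<in> edges T \<Longrightarrow> n \<notin> e" for e
    using T n by (auto simp: is_tree_def finite_simple_graph_def)
  have nb: "x = s" if "{n, x} \<in> edges ?T" for x using that nE by (auto simp: doubleton_eq_iff)
  have pp: "p \<noteq> []" "distinct p" "hd p = t1" "last p = t3"
    "successively (\<lambda>x y. {x, y} \<in> edges ?T) p"
    using p by (auto simp: is_path_between_def is_path_def walk_edges_iff)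
  have ipp: "is_path ?T p" using p by (simp add: is_path_between_def)
  show ?thesis
  proof (cases "n \<in> set p")
    case False
    then have "is_path_between T t1 p t3"
      using path_drop_leaf[OF ipp] pp by (simp add: is_path_between_def)
    moreover have "t1 \<noteq> n" "t3 \<noteq> n" "t2 \<noteq> n" using False pp t2 by auto
    ultimately show ?thesis using path t2 by auto
  next
    case True
    then obtain p1 p2 where p12: "p = p1 @ n # p2" by (meson split_list)
    have e1: "last p1 = s" if "p1 \<noteq> []"
      using pp(5) p12 that nb by (auto simp: successively_append_iff insert_commute)
    have e2: "hd p2 = s" if "p2 \<noteq> []"
      using pp(5) p12 that nb by (cases p2) (auto simp: successively_append_iff insert_commute)
    have "\<not> (p1 \<noteq> [] \<and> p2 \<noteq> [])"
    proof
      assume ne: "p1 \<noteq> [] \<and> p2 \<noteq> []"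
      then have "s \<in> set p1" "s \<in> set p2" using e1 e2 last_in_set hd_in_set by metis+
      then show False using pp(2) p12 by auto
    qed
    then consider "p = [n]" | "p1 = []" "p2 \<noteq> []" | "p1 \<noteq> []" "p2 = []" using p12 by auto
    then show ?thesis
    proof cases
      case 1
      then show ?thesis using pp t2 by auto
    next
      case 2
      have "is_path ?T p2" using ipp p12 2 by (cases p2) (auto simp: is_path_def)
      then have "is_path_between T s p2 t3"
        using path_drop_leaf[of n T s p2] pp p12 2 e2 by (auto simp: is_path_between_def)
      then have "\<And>t. t \<in> set p2 \<Longrightarrow> P s \<inter> P t3 \<subseteq> P t" using path by blast
      moreover have "t1 = n" "t3 \<in> set p2" using pp p12 2 by auto
      moreover have "t3 \<noteq> n" "t3 \<in> verts T" using \<open>t3 \<in> set p2\<close> pp p12 ipp by (auto simp: is_path_def)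
      ultimately show ?thesis using B t2 p12 2 by (cases "t2 = n") auto
    next
      case 3
      have "is_path ?T p1"
        using ipp p12 3 by (auto simp: is_path_def walk_edges_iff successively_append_iff)
      then have "is_path_between T t1 p1 s"
        using path_drop_leaf[of n T s p1] pp p12 3 e1 by (auto simp: is_path_between_def)
      then have "\<And>t. t \<in> set p1 \<Longrightarrow> P t1 \<inter> P s \<subseteq> P t" using path by blast
      moreover have "t3 = n" "t1 \<in> set p1" using pp p12 3 by auto
      moreover have "t1 \<noteq> n" "t1 \<in> verts T" using \<open>t1 \<in> set p1\<close> pp p12 ipp by (auto simp: is_path_def)
      ultimately show ?thesis using B t2 p12 3 by (cases "t2 = n") auto
    qed
  qed
qed

lemma partial_decomposition_add_leaf:
  assumes pd: "partial_decomposition G N T P"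
    and att: "verts T = {} \<or> (\<exists>s\<in>verts T. B \<inter> \<Union>(P ` verts T) \<subseteq> P s)"
    and B: "connected_in G B" "card B \<le> N"
  shows "\<exists>T' P' n. partial_decomposition G N T' P' \<and> verts T' = insert n (verts T) \<and>
           (\<forall>t\<in>verts T. P' t = P t) \<and> P' n = B"
proof (cases "verts T = {}")
  case True
  let ?T = "\<lparr>verts = {0}, edges = {}\<rparr> :: nat graph"
  have single: "set p = {0}" if "is_path ?T p" for p
    using that by (cases p) (auto simp: is_path_def)
  have "\<not> is_cycle ?T c" for c by (auto simp: is_cycle_def cycle_edges_def)
  moreover have "connected_graph ?T" by (simp add: connected_graph_iff connset_def)
  ultimately have "is_tree ?T" by (simp add: is_tree_def finite_simple_graph_def)
  moreover have "t1 = 0 \<and> t3 = 0" if "is_path_between ?T t1 p t3" for t1 p t3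
    using that single[of p] hd_in_set[of p] last_in_set[of p]
    by (auto simp: is_path_between_def is_path_def)
  moreover have "t2 = 0" if "is_path_between ?T t1 p t3" "t2 \<in> set p" for t1 t2 t3 p
    using that single[of p] by (auto simp: is_path_between_def)
  ultimately have "partial_decomposition G N ?T (\<lambda>_. B)"
    using B unfolding partial_decomposition_def by auto
  then show ?thesis using True by (intro exI[of _ ?T] exI[of _ "\<lambda>_. B"] exI[of _ 0]) simp
next
  case False
  then obtain s where s: "s \<in> verts T" "B \<inter> \<Union>(P ` verts T) \<subseteq> P s" using att by auto
  have T: "is_tree T" using pd False by (simp add: partial_decomposition_def)
  then have "finite (verts T)" by (simp add: is_tree_def finite_simple_graph_def)
  then obtain n where n: "n \<notin> verts T" using ex_new_if_finite infinite_UNIV_nat by metis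
  let ?T = "\<lparr>verts = insert n (verts T), edges = insert {n, s} (edges T)\<rparr>"
  have "is_tree ?T" using is_tree_add_leaf[OF T s(1) n] .
  moreover have "\<forall>t\<in>verts ?T. connected_in G ((P(n := B)) t) \<and> card ((P(n := B)) t) \<le> N"
    using pd B by (auto simp: partial_decomposition_def)
  moreover have "\<forall>t1 t2 t3 p. is_path_between T t1 p t3 \<and> t2 \<in> set p \<longrightarrow> P t1 \<inter> P t3 \<subseteq> P t2"
    using pd unfolding partial_decomposition_def by (elim conjE)
  note leaf = leaf_path_property[OF T s(1) n this s(2)]
  have "\<forall>t1 t2 t3 p. is_path_between ?T t1 p t3 \<and> t2 \<in> set p \<longrightarrow>
      (P(n := B)) t1 \<inter> (P(n := B)) t3 \<subseteq> (P(n := B)) t2"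
    by (intro allI impI, elim conjE, rule leaf)
  ultimately have "partial_decomposition G N ?T (P(n := B))"
    unfolding partial_decomposition_def by simp
  then show ?thesis
    using n by (intro exI[of _ ?T] exI[of _ "P(n := B)"] exI[of _ n]) auto
qed

section \<open>Building the connected tree-decomposition\<close>

text \<open>The contract for processing a territory. Old nodes keep their parts, so places of
  attachment stay valid, and only vertices of \<open>C\<close> become newly covered, so disjoint
  territories do not disturb each other.\<close>

definition extends :: "'a graph \<Rightarrow> nat \<Rightarrow> nat graph \<Rightarrow> (nat \<Rightarrow> 'a set) \<Rightarrow> nat graph \<Rightarrow> (nat \<Rightarrow> 'a set) \<Rightarrow> 'a set \<Rightarrow> bool" where
  "extends G N T P T' P' C \<longleftrightarrow> partial_decomposition G N T' P' \<and> verts T \<subseteq> verts T' \<and>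
     (\<forall>t\<in>verts T. P' t = P t) \<and> \<Union>(P' ` verts T') = \<Union>(P ` verts T) \<union> C \<and>
     (\<forall>e\<in>edges G. e \<inter> C \<noteq> {} \<longrightarrow> (\<exists>t\<in>verts T'. e \<subseteq> P' t))"

text \<open>
  \<open>A\<close> is the part of \<open>C\<close> already covered; a new leaf for \<open>C\<close> can be attached at \<open>s\<close>.
\<close>

definition attachable :: "'a graph \<Rightarrow> nat \<Rightarrow> nat graph \<Rightarrow> (nat \<Rightarrow> 'a set) \<Rightarrow> 'a set \<Rightarrow> 'a set \<Rightarrow> bool" where
  "attachable G N T P C A \<longleftrightarrow> partial_decomposition G N T P \<and> \<Union>(P ` verts T) \<inter> C = A \<and>
     (verts T = {} \<and> nbs (edges G) C = {} \<or> (\<exists>s\<in>verts T. nbs (edges G) C \<union> A \<subseteq> P s))"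

lemma extends_trans:
  assumes 1: "extends G N T P T1 P1 C" and 2: "extends G N T1 P1 T2 P2 D"
  shows "extends G N T P T2 P2 (C \<union> D)"
  unfolding extends_def
proof (intro conjI ballI impI)
  note a = 1[unfolded extends_def] and b = 2[unfolded extends_def]
  show "partial_decomposition G N T2 P2" "verts T \<subseteq> verts T2" using a b by auto
  show "\<Union>(P2 ` verts T2) = \<Union>(P ` verts T) \<union> (C \<union> D)" using a b by (simp add: Un_assoc)
  show "P2 t = P t" if "t \<in> verts T" for t using a b that by auto
  fix e assume e: "e \<in> edges G" "e \<inter> (C \<union> D) \<noteq> {}"
  show "\<exists>t\<in>verts T2. e \<subseteq> P2 t"
  proof (cases "e \<inter> C = {}")
    case True
    then have "e \<inter> D \<noteq> {}" using e by auto
    then show ?thesis using b e by simp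
  next
    case False
    then have "\<exists>t\<in>verts T1. e \<subseteq> P1 t" using a e(1) by simp
    then obtain t where "t \<in> verts T1" "e \<subseteq> P1 t" by auto
    then show ?thesis using b by (intro bexI[of _ t]) auto
  qed
qed

lemma attachable_extends:
  assumes att: "attachable G N T P C A" and ext: "extends G N T P T' P' D" and disj: "C \<inter> D = {}" "D \<noteq> {}"
  shows "attachable G N T' P' C A"
proof -
  note a = att[unfolded attachable_def] and e = ext[unfolded extends_def]
  have "\<exists>s\<in>verts T'. nbs (edges G) C \<union> A \<subseteq> P' s"
  proof (cases "verts T = {}")
    case True
    then have "nbs (edges G) C \<union> A = {}" using a by auto
    moreover have "verts T' \<noteq> {}" using e disj by auto
    ultimately show ?thesis by auto
  next
    case False
    then obtain s where s: "s \<in> verts T" "nbs (edges G) C \<union> A \<subseteq> P s" using a by auto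
    then have "s \<in> verts T'" "P' s = P s" using e by auto
    then show ?thesis using s by (intro bexI[of _ s]) simp_all
  qed
  moreover have "\<Union>(P' ` verts T') \<inter> C = A" using a e disj by auto
  ultimately show ?thesis using e unfolding attachable_def by simp
qed

text \<open>Sibling territories are disjoint, so processing one leaves the others attachable with
  the same covered part.\<close>

lemma extend_all:
  assumes "finite \<K>" and "\<And>K K'. \<lbrakk>K \<in> \<K>; K' \<in> \<K>; K \<noteq> K'\<rbrakk> \<Longrightarrow> K \<inter> K' = {}" and "\<And>K. K \<in> \<K> \<Longrightarrow> K \<noteq> {}"
    and "\<And>K. K \<in> \<K> \<Longrightarrow> attachable G N T P K (A K)"
    and "\<And>K T P. \<lbrakk>K \<in> \<K>; attachable G N T P K (A K)\<rbrakk> \<Longrightarrow> \<exists>T' P'. extends G N T P T' P' K"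
    and "partial_decomposition G N T P"
  shows "\<exists>T' P'. extends G N T P T' P' (\<Union>\<K>)"
  using assms
proof (induction arbitrary: T P rule: finite_induct)
  case empty
  then show ?case by (intro exI[of _ T] exI[of _ P]) (simp add: extends_def)
next
  case (insert K \<K>)
  obtain T1 P1 where 1: "extends G N T P T1 P1 K"
    using insert.prems(4)[OF insertI1 insert.prems(3)[OF insertI1]] by auto
  have "\<exists>T2 P2. extends G N T1 P1 T2 P2 (\<Union>\<K>)"
  proof (rule insert.IH)
    show "partial_decomposition G N T1 P1" using 1 by (simp add: extends_def)
    show "attachable G N T1 P1 K' (A K')" if K': "K' \<in> \<K>" for K'
    proof (rule attachable_extends[OF _ 1])
      show "attachable G N T P K' (A K')" using insert.prems(3) K' by simp
      show "K' \<inter> K = {}" using insert.prems(1)[of K' K] K' insert.hyps by auto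
      show "K \<noteq> {}" using insert.prems(2) by simp
    qed
  qed (use insert.prems in simp_all)
  then obtain T2 P2 where "extends G N T1 P1 T2 P2 (\<Union>\<K>)" by auto
  then have "extends G N T P T2 P2 (K \<union> \<Union>\<K>)" using extends_trans 1 by metis
  then show ?case by auto
qed

lemma connset_closed_nbs:
  assumes "connset E C"
  shows "connset E (C \<union> nbs E C)"
proof -
  obtain z where z: "z \<in> C" using connset_nonempty[OF assms] by auto
  show ?thesis
  proof (rule connset_reachI[of z])
    fix u assume u: "u \<in> C \<union> nbs E C"
    show "(z, u) \<in> reach E (C \<union> nbs E C)"
    proof (cases "u \<in> C")
      case True
      then show ?thesis using connset_reach[OF assms z True] by auto
    next
      case False
      then obtain c where c: "c \<in> C" "{c, u} \<in> E" using u by (auto simp: nbs_def)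
      then have "(z, c) \<in> reach E (C \<union> nbs E C)" using connset_reach[OF assms z, of c] by auto
      then show ?thesis using reach_edge[of c _ u E] c u reach_trans by (metis UnI1)
    qed
  qed (use z in auto)
qed

lemma finite_comps: "finite W \<Longrightarrow> finite (comps E W)"
  by (rule finite_subset[of _ "Pow W"]) (auto simp: comps_def)

text \<open>At least one block remains, so there were at most \<open>card X - 1\<close> links with
  at most \<open>l - 3\<close> inner vertices each.\<close>

lemma linked_bag_bound:
  assumes "linked E (l - 3) X P" "finite X" "X \<noteq> {}" "card X \<le> k" "3 \<le> l"
  shows "card (\<Union>P) \<le> (k - 1) * (l - 2) + 1"
proof -
  note c = linked_card[OF assms(1,2)]
  have "P \<noteq> {}" using linked_covers[OF assms(1)] assms(3) by auto
  then have "card P \<ge> 1" using c by (simp add: Suc_leI card_gt_0_iff)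
  then have "card (\<Union>P) \<le> card X + (l - 3) * (card X - 1)"
    using c mult_le_mono2[of "card X - card P" "card X - 1" "l - 3"] by linarith
  also obtain i where i: "card X = Suc i" using assms(2,3) by (cases "card X") auto
  \<comment> \<open>Each of the \<open>i\<close> links accounts for one further vertex of
    \<open>X\<close>, which turns \<open>l - 3\<close> into \<open>l - 2\<close>.\<close>
  then have "card X + (l - 3) * (card X - 1) = i * (l - 2) + 1"
    using assms(5) by (auto simp: le_iff_add algebra_simps)
  also have "i * (l - 2) \<le> (k - 1) * (l - 2)" using assms(4) i by (intro mult_le_mono1) auto
  finally show ?thesis by simp
qed

section \<open>The recursion over territories\<close>

text \<open>\<open>X0\<close> and \<open>Q0\<close> are the bag and the links of the parent, and
  \<open>\<Union>Q0 \<inter> C\<close> is what existing nodes already cover in \<open>C\<close>.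
  That the boundary is joined outside \<open>C\<close> permits an irreducible bag, and its
  irreducibility provides the same property for every child. \<open>\<Phi>\<close> is chosen anew
  for each territory.\<close>

lemma extend_component:
  fixes G :: "'a graph" and l k :: nat
  defines "E \<equiv> edges G" and "V \<equiv> verts G" and "N \<equiv> (k - 1) * (l - 2) + 1"
  assumes G: "finite_simple_graph G" and gen: "cycles_generate G l" and l: "3 \<le> l"
  shows "\<lbrakk>win E k \<Phi> C; connset E C; C \<union> nbs E C \<subseteq> V;
    \<And>x y. \<lbrakk>x \<in> nbs E C; y \<in> nbs E C\<rbrakk> \<Longrightarrow> (x, y) \<in> reach E (V - C);
    linked E (l - 3) X0 Q0; C \<inter> X0 = {}; nbs E C \<subseteq> X0; attachable G N T P C (\<Union>Q0 \<inter> C)\<rbrakk>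
    \<Longrightarrow> \<exists>T' P'. extends G N T P T' P' C"
proof (induction "card C" arbitrary: \<Phi> C X0 Q0 T P rule: less_induct)
  case less
  note CV = less.prems(3)
  have finV: "finite V" using G by (simp add: V_def finite_simple_graph_def)
  obtain \<Phi>' X where bag: "win_bag E k \<Phi>' C X"
    and irr: "\<forall>K\<in>comps E (C - X). \<forall>x\<in>X. \<forall>y\<in>X. (x, y) \<in> reach E (V - K)"
    using win_irreducible_bag[OF less.prems(1) finV CV less.prems(2,4)] by auto
  note b = bag[unfolded win_bag_def]
  have XW: "nbs E C \<subseteq> X" "X \<subseteq> C \<union> nbs E C" "X \<inter> C \<noteq> {}" "card X \<le> k"
    and children: "\<And>K. K \<in> comps E (C - X) \<Longrightarrow> win E k \<Phi>' K"
    using b by simp_all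
  have finX: "finite X" using finite_subset[OF _ finV, of X] XW(2) CV by auto
  obtain Q1 where Q1: "linked E (l - 3) X Q1" "\<Union>Q1 = X \<union> (\<Union>Q0 \<inter> C)"
    using linked_inherit[OF less.prems(5,6,7) XW(1,2)] by auto
  have "\<exists>Q. linked E (l - 3) X Q \<and> \<Union>Q1 \<subseteq> \<Union>Q \<and> \<Union>Q \<subseteq> C \<union> nbs E C \<and> connset E (\<Union>Q)"
  proof (rule linked_connect[OF G gen E_def[THEN meta_eq_to_obj_eq] V_def[THEN meta_eq_to_obj_eq] CV _ XW(1) _ finX _ Q1(1)])
    show "connset E (C \<union> nbs E C)" using connset_closed_nbs[OF less.prems(2)] .
    show "X \<noteq> {}" using XW(3) by auto
    show "\<Union>Q1 \<subseteq> C \<union> nbs E C" using Q1(2) XW(2) by auto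
  qed (use irr in auto)
  then obtain Q F where Q: "linked E (l - 3) X Q" "F = \<Union>Q" "\<Union>Q1 \<subseteq> F" "F \<subseteq> C \<union> nbs E C" "connset E F"
    by auto
  have XF: "X \<subseteq> F" and Q0F: "\<Union>Q0 \<inter> C \<subseteq> F" using Q(3) Q1(2) by auto
  define U where "U = \<Union>(P ` verts T)"
  note att = less.prems(8)[unfolded attachable_def, folded E_def U_def]
  have UC: "U \<inter> C = \<Union>Q0 \<inter> C" using att by simp
  have "verts T = {} \<or> (\<exists>s\<in>verts T. F \<inter> U \<subseteq> P s)"
  proof (cases "verts T = {}")
    case False
    then obtain s where "s \<in> verts T" "nbs E C \<union> (\<Union>Q0 \<inter> C) \<subseteq> P s" using att by auto
    \<comment> \<open>The new part meets the covered vertices only in the boundary and in inherited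
      links, and the part at \<open>s\<close> contains both.\<close>
    moreover have "F \<inter> U \<subseteq> nbs E C \<union> (\<Union>Q0 \<inter> C)" using Q(4) UC by auto
    ultimately show ?thesis by blast
  qed simp
  moreover have "connected_in G F" using Q(4,5) CV by (auto simp: connected_in_iff E_def V_def)
  moreover have "card F \<le> N"
    using linked_bag_bound[OF Q(1) finX _ XW(4) l] XW(3) Q(2) by (auto simp: N_def)
  moreover have "partial_decomposition G N T P" using att by simp
  ultimately obtain T1 P1 n where T1: "partial_decomposition G N T1 P1" "verts T1 = insert n (verts T)"
    "\<forall>t\<in>verts T. P1 t = P t" "P1 n = F"
    using partial_decomposition_add_leaf[of G N T P F] unfolding U_def by auto
  have U1: "\<Union>(P1 ` verts T1) = U \<union> F" using T1(2-4) by (auto simp: U_def)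
  have "\<exists>T2 P2. extends G N T1 P1 T2 P2 (\<Union>(comps E (C - X)))"
  proof (rule extend_all[where A = "\<lambda>K. F \<inter> K"])
    show "finite (comps E (C - X))" using finite_comps finite_subset[OF _ finV, of C] CV by auto
    show "K \<inter> K' = {}" if "K \<in> comps E (C - X)" "K' \<in> comps E (C - X)" "K \<noteq> K'" for K K'
      using comps_disjoint that by metis
    fix K assume K: "K \<in> comps E (C - X)"
    note k = compsD[OF K]
    show "K \<noteq> {}" by fact
    have nK: "nbs E K \<subseteq> X" using comps_nbs[OF K] XW(1) by auto
    \<comment> \<open>\<open>F\<close> has taken in everything of \<open>C\<close> that was covered
      before, so its own links describe what is covered in the child.\<close>
    have "(U \<union> F) \<inter> K = F \<inter> K" using UC Q0F k(2) by blast
    then show "attachable G N T1 P1 K (F \<inter> K)"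
      unfolding attachable_def U1 using T1 nK XF unfolding E_def by auto
    fix T' P' assume a: "attachable G N T' P' K (F \<inter> K)"
    show "\<exists>T'' P''. extends G N T' P' T'' P'' K"
    proof (rule less.hyps[OF _ children[OF K] k(1) _ _ Q(1) _ nK])
      have "K \<subset> C" using k(2) XW(3) by auto
      then show "card K < card C" using psubset_card_mono finite_subset[OF _ finV, of C] CV by auto
      show "K \<union> nbs E K \<subseteq> V" using nK k(2) XW(2) CV by auto
      show "(x, y) \<in> reach E (V - K)" if "x \<in> nbs E K" "y \<in> nbs E K" for x y
        using irr K nK that by auto
      show "K \<inter> X = {}" using k(2) by auto
      show "attachable G N T' P' K (\<Union>Q \<inter> K)" using a Q(2) by simp
    qed
  qed (rule T1(1))
  then obtain T2 P2 where T2: "extends G N T1 P1 T2 P2 (C - X)" by (auto simp: Union_comps)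
  note e = T2[unfolded extends_def]
  have "extends G N T P T2 P2 C"
    unfolding extends_def
  proof (intro conjI ballI impI)
    show "partial_decomposition G N T2 P2" "verts T \<subseteq> verts T2" using e T1(2) by auto
    show "P2 t = P t" if "t \<in> verts T" for t using e T1(2,3) that by auto
    have "nbs E C \<subseteq> U" using att by (auto simp: U_def)
    moreover have "\<Union>(P2 ` verts T2) = U \<union> F \<union> (C - X)" using e U1 by simp
    ultimately show "\<Union>(P2 ` verts T2) = \<Union>(P ` verts T) \<union> C"
      unfolding U_def[symmetric] using XF Q(4) by auto
    fix e' assume e': "e' \<in> edges G" "e' \<inter> C \<noteq> {}"
    show "\<exists>t\<in>verts T2. e' \<subseteq> P2 t"
    proof (cases "e' \<inter> (C - X) = {}")
      \<comment> \<open>An edge that meets \<open>C\<close> but not \<open>C - X\<close> has both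
        ends in \<open>X\<close>, so the new part contains it. The children take care of the
        others.\<close>
      case True
      have "card e' = 2" using e' G by (simp add: finite_simple_graph_def)
      then obtain u v where uv: "e' = {u, v}" by (auto simp: card_2_iff)
      have "x \<in> C \<union> nbs E C" if "{x, y} = e'" "y \<in> C" for x y
        using e' that by (auto simp: nbs_def E_def insert_commute)
      then have "e' \<subseteq> C \<union> nbs E C" using e'(2) uv by (auto simp: insert_commute)
      then have "e' \<subseteq> F" using True XW(1) XF by auto
      moreover have "n \<in> verts T2" "P2 n = F" using e T1(2,4) by auto
      ultimately show ?thesis by auto
    qed (use e e' in auto)
  qed
  then show ?case by auto
qed

text \<open>The construction starts from the empty tree. The first territories are the components of
  \<open>G\<close>; they have no boundary and no inherited links, hence the empty partition of the
  empty bag.\<close>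

lemma connected_decomposition_exists:
  assumes G: "finite_simple_graph G" and gen: "cycles_generate G l" and l: "3 \<le> l" and ne: "verts G \<noteq> {}"
    and td: "tree_decomposition G T P" and k: "\<And>t. t \<in> verts T \<Longrightarrow> card (P t) \<le> k"
  shows "\<exists>T' :: nat graph. \<exists>P'. connected_tree_decomposition G T' P' \<and>
    (\<forall>t\<in>verts T'. card (P' t) \<le> (k - 1) * (l - 2) + 1)"
proof -
  let ?N = "(k - 1) * (l - 2) + 1" and ?T0 = "\<lparr>verts = {}, edges = {}\<rparr> :: nat graph" and ?P0 = "\<lambda>_ :: nat. {} :: 'a set"
  have finV: "finite (verts G)" and EV: "\<And>e. e \<in> edges G \<Longrightarrow> e \<subseteq> verts G \<and> e \<noteq> {}"
    using G by (auto simp: finite_simple_graph_def)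
  have pd0: "partial_decomposition G ?N ?T0 ?P0" by (simp add: partial_decomposition_def)
  have no_nbs: "nbs (edges G) K = {}" if K: "K \<in> comps (edges G) (verts G)" for K
    using compsD(3)[OF K] EV by (auto simp: nbs_def)
  have "\<exists>T' P'. extends G ?N ?T0 ?P0 T' P' (\<Union>(comps (edges G) (verts G)))"
  proof (rule extend_all[where A = "\<lambda>_. {}"])
    show "finite (comps (edges G) (verts G))" using finite_comps finV .
    show "K \<inter> K' = {}" if "K \<in> comps (edges G) (verts G)" "K' \<in> comps (edges G) (verts G)" "K \<noteq> K'" for K K'
      using comps_disjoint that by metis
    fix K assume K: "K \<in> comps (edges G) (verts G)"
    note k' = compsD[OF K]
    show "K \<noteq> {}" by fact
    show "attachable G ?N ?T0 ?P0 K {}" using pd0 no_nbs[OF K] by (simp add: attachable_def)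
    fix T' P' assume a: "attachable G ?N T' P' K {}"
    have win: "win (edges G) k UNIV K"
      using tree_decomposition_win[OF td k G k'(1,2)] no_nbs[OF K] by simp
    have "linked (edges G) (l - 3) {} {}" using linked.singletons[of _ _ "{}"] by simp
    show "\<exists>T'' P''. extends G ?N T' P' T'' P'' K"
      by (rule extend_component[OF G gen l win k'(1) _ _ \<open>linked (edges G) (l - 3) {} {}\<close>])
         (use k'(2) no_nbs[OF K] a in auto)
  qed (rule pd0)
  then obtain T' P' where ext: "extends G ?N ?T0 ?P0 T' P' (verts G)" by (auto simp: Union_comps)
  note e = ext[unfolded extends_def]
  have U: "verts G = (\<Union>t\<in>verts T'. P' t)" using e by simp
  then have "verts T' \<noteq> {}" using ne by auto
  then have pd: "is_tree T'"
    "\<forall>t1 t2 t3 p. is_path_between T' t1 p t3 \<and> t2 \<in> set p \<longrightarrow> P' t1 \<inter> P' t3 \<subseteq> P' t2"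
    "\<forall>t\<in>verts T'. connected_in G (P' t) \<and> card (P' t) \<le> ?N"
    using e unfolding partial_decomposition_def by (metis, metis, metis)
  have "\<exists>t\<in>verts T'. x \<subseteq> P' t" if "x \<in> edges G" for x
  proof -
    have "x \<inter> verts G \<noteq> {}" using EV[OF that] by auto
    then show ?thesis using e that by simp
  qed
  then have "connected_tree_decomposition G T' P'"
    unfolding connected_tree_decomposition_def tree_decomposition_def using pd U by simp
  then show ?thesis using pd(3) by blast
qed

section \<open>Widths and minima\<close>

text \<open>Integers are not well-ordered, so the least element is found among natural numbers after
  a shift by the lower bound \<open>b\<close>.\<close>

lemma Least_int:
  fixes Q :: "int \<Rightarrow> bool"
  assumes "Q w" and bound: "\<And>w. Q w \<Longrightarrow> b \<le> w"
  shows "Q (LEAST w. Q w)" "(LEAST w. Q w) \<le> w"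
proof -
  define n where "n = (LEAST n. Q (b + int n))"
  have ex: "\<exists>n. v = b + int n" if "Q v" for v
    using bound[OF that] by (intro exI[of _ "nat (v - b)"]) simp
  then obtain m where "Q (b + int m)" using assms(1) by metis
  then have n: "Q (b + int n)" unfolding n_def by (rule LeastI)
  have le: "b + int n \<le> v" if "Q v" for v
    using ex[OF that] Least_le[of "\<lambda>n. Q (b + int n)"] that by (auto simp: n_def)
  have "(LEAST w. Q w) = b + int n" using n le by (rule Least_equality)
  then show "Q (LEAST w. Q w)" "(LEAST w. Q w) \<le> w" using n le assms(1) by simp_all
qed

lemma tree_decomposition_nodes:
  assumes "tree_decomposition G T P"
  shows "finite (verts T)" "verts T \<noteq> {}"
  using tree_decompositionD(1)[OF assms]
  by (auto simp: is_tree_def finite_simple_graph_def connected_graph_def)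

lemma width_ge:
  assumes "tree_decomposition G T P" "t \<in> verts T"
  shows "int (card (P t)) - 1 \<le> width T P"
  unfolding width_def using tree_decomposition_nodes[OF assms(1)] assms(2) by (intro Max_ge) auto

lemma width_le:
  assumes "tree_decomposition G T P" "\<And>t. t \<in> verts T \<Longrightarrow> int (card (P t)) - 1 \<le> w"
  shows "width T P \<le> w"
  unfolding width_def using tree_decomposition_nodes[OF assms(1)] assms(2) by (subst Max_le_iff) auto

lemma width_ge_minus_one: "tree_decomposition G T P \<Longrightarrow> -1 \<le> width T P"
  using width_ge tree_decomposition_nodes(2) by fastforce

lemma single_bag_decomposition:
  assumes "finite_simple_graph G"
  shows "\<exists>T :: nat graph. \<exists>P. tree_decomposition G T P"
proof -
  let ?T = "\<lparr>verts = {0}, edges = {}\<rparr> :: nat graph"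
  have "\<not> is_cycle ?T c" for c by (auto simp: is_cycle_def cycle_edges_def)
  moreover have "connected_graph ?T" by (simp add: connected_graph_iff connset_def)
  ultimately have "is_tree ?T" by (simp add: is_tree_def finite_simple_graph_def)
  then have "tree_decomposition G ?T (\<lambda>_. verts G)"
    using assms by (auto simp: tree_decomposition_def finite_simple_graph_def)
  then show ?thesis by blast
qed

text \<open>No cycle is longer than the number of vertices, so the minimum that defines
  \<open>cycle_generation_length\<close> is attained.\<close>

lemma cycles_generate_exists:
  assumes "finite_simple_graph G"
  shows "cycles_generate G (card (verts G))"
proof -
  have "length c \<le> card (verts G)" if "is_cycle G c" for c
    using that assms card_mono[of "verts G" "set c"] distinct_card[of c]
    by (auto simp: is_cycle_def finite_simple_graph_def)
  then have "{cycle_vector c | c. is_cycle G c \<and> length c \<le> card (verts G)} = {cycle_vector c | c. is_cycle G c}"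
    by blast
  then show ?thesis by (simp add: cycles_generate_def cycle_space_def)
qed

text \<open>For smaller \<open>l\<close> the span is trivial, whereas the vector of \<open>c\<close>
  is nonzero. The bound keeps \<open>l - 2\<close> and \<open>l - 3\<close> from truncating.\<close>

lemma cycles_generate_ge_3:
  assumes "is_cycle G c" "cycles_generate G l"
  shows "3 \<le> l"
proof (rule ccontr)
  assume "\<not> 3 \<le> l"
  then have "{cycle_vector c | c. is_cycle G c \<and> length c \<le> l} = {}" by (auto simp: is_cycle_def)
  then have "edge_space.span {cycle_vector c | c. is_cycle G c \<and> length c \<le> l} = {0}"
    by (simp only: edge_space.span_empty)
  then have "cycle_space G = {0}" using assms(2) by (simp only: cycles_generate_def)
  moreover have "cycle_vector c \<in> cycle_space G"
    unfolding cycle_space_def using assms(1) by (intro edge_space.span_base) auto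
  ultimately have "cycle_vector c {last c, hd c} = 0" by simp
  then show False by (simp add: cycle_vector_def cycle_edges_def)
qed

theorem theorem2:
  fixes G :: "'a graph"
  assumes "finite_simple_graph G"
    and "\<exists>c. is_cycle G c"
  shows "connected_tree_width G \<le> tree_width G * (int (cycle_generation_length G) - 2)"
proof -
  let ?l = "cycle_generation_length G"
  obtain c where c: "is_cycle G c" using assms(2) by auto
  have gen: "cycles_generate G ?l"
    unfolding cycle_generation_length_def using cycles_generate_exists[OF assms(1)] by (rule LeastI)
  have l: "3 \<le> ?l" using cycles_generate_ge_3[OF c gen] .
  have "hd c \<in> verts G" using c by (cases c) (auto simp: is_cycle_def)
  then have ne: "verts G \<noteq> {}" by auto
  let ?Q = "\<lambda>w. \<exists>(T :: nat graph) P. tree_decomposition G T P \<and> width T P = w"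
  obtain T0 :: "nat graph" and P0 where "tree_decomposition G T0 P0"
    using single_bag_decomposition[OF assms(1)] by auto
  then have "?Q (width T0 P0)" by auto
  then have "?Q (tree_width G)"
    unfolding tree_width_def by (rule Least_int(1)[where b = "-1"]) (auto dest: width_ge_minus_one)
  then obtain T :: "nat graph" and P where td: "tree_decomposition G T P" and w: "width T P = tree_width G"
    by auto
  \<comment> \<open>A bound on the part sizes, one more than the width.\<close>
  define k where "k = nat (tree_width G + 1)"
  have k: "card (P t) \<le> k" if "t \<in> verts T" for t
    using width_ge[OF td that] w by (simp add: k_def)
  \<comment> \<open>This makes the natural number \<open>k - 1\<close> equal to the
    tree-width.\<close>
  have k1: "1 \<le> k"
  proof -
    obtain t where "t \<in> verts T" "hd c \<in> P t"
      using \<open>hd c \<in> verts G\<close> tree_decompositionD(2)[OF td] by auto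
    moreover have "finite (P t)"
      using finite_subset[of "P t" "verts G"] tree_decompositionD(2)[OF td] \<open>t \<in> verts T\<close> assms(1)
      by (auto simp: finite_simple_graph_def)
    ultimately have "card (P t) \<noteq> 0" by auto
    then show ?thesis using k[OF \<open>t \<in> verts T\<close>] by simp
  qed
  have bound: "int ((k - 1) * (?l - 2) + 1) - 1 = tree_width G * (int ?l - 2)"
    using k1 l by (simp add: k_def of_nat_diff)
  obtain T' :: "nat graph" and P' where ctd: "connected_tree_decomposition G T' P'"
    and card: "\<And>t. t \<in> verts T' \<Longrightarrow> card (P' t) \<le> (k - 1) * (?l - 2) + 1"
    using connected_decomposition_exists[OF assms(1) gen l ne td k] by blast
  have td': "tree_decomposition G T' P'" using ctd by (simp add: connected_tree_decomposition_def)
  have "width T' P' \<le> int ((k - 1) * (?l - 2) + 1) - 1"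
    by (rule width_le[OF td']) (use card in \<open>simp only: of_nat_le_iff diff_mono\<close>)
  moreover have "connected_tree_width G \<le> width T' P'"
    unfolding connected_tree_width_def
    by (rule Least_int(2)[where b = "-1"])
       (use ctd in \<open>auto simp: connected_tree_decomposition_def dest: width_ge_minus_one\<close>)
  ultimately show ?thesis unfolding bound by simp
qed

end
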